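(* Let $(M,\phi,\xi,\eta,g)$ be a non-Sasakian contact metric $(\kappa,\mu)$-manifold of dimension $2n+1$ and let $\lambda:=\sqrt{1-\kappa}$. Then the operator $\phi h$ admits three eigenvalues: $0$, of multiplicity $1$, and $\lambda$, $-\lambda$, each of multiplicity $n$. The corresponding eigendistributions are $\mathcal D_{\phi h}(0)=\mathbb R\xi$ and $$\mathcal D_{\phi h}(\lambda)=\{X+\phi X \mid X\in\Gamma(\mathcal D_h(\lambda))\},\qquad \mathcal D_{\phi h}(-\lambda)=\{Y+\phi Y \mid Y\in\Gamma(\mathcal D_h(-\lambda))\}.$$ Furthermore, $\mathcal D_{\phi h}(\lambda)$ and $\mathcal D_{\phi h}(-\lambda)$ define two mutually orthogonal Legendre foliations which are transversal to the canonical bi-Legendrian structure $(\mathcal D_h(\lambda),\mathcal D_h(-\lambda))$.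
   Context: Everything is smooth. A contact metric manifold $(M,\phi,\xi,\eta,g)$ is a $(2n+1)$-dimensional manifold with a $(1,1)$-tensor $\phi$, vector field $\xi$, $1$-form $\eta$ and Riemannian metric $g$ such that $\phi^2=-I+\eta\otimes\xi$, $\eta(\xi)=1$, $g(\phi X,\phi Y)=g(X,Y)-\eta(X)\eta(Y)$ and $d\eta(X,Y)=g(X,\phi Y)$, where $2d\eta(X,Y)=X(\eta(Y))-Y(\eta(X))-\eta([X,Y])$. Then $\eta$ is a contact form with Reeb vector field $\xi$; $\mathcal D=\ker\eta$; $h:=\frac12\mathcal L_\xi\phi$. It is Sasakian if $[\phi,\phi]+2d\eta\otimes\xi=0$, where $[\phi,\phi](X,Y)=\phi^2[X,Y]+[\phi X,\phi Y]-\phi[\phi X,Y]-\phi[X,\phi Y]$. A contact metric $(\kappa,\mu)$-manifold (or $(\kappa,\mu)$-space), $\kappa,\mu\in\mathbb R$, is a contact metric manifold whose Levi-Civita curvature $R^g(X,Y)=[\nabla^g_X,\nabla^g_Y]-\nabla^g_{[X,Y]}$ satisfies $R^g(X,Y)\xi=\kappa(\eta(Y)X-\eta(X)Y)+\mu(\eta(Y)hX-\eta(X)hY)$ for all $X,Y$. Known facts: $\kappa\le1$; if non-Sasakian then $\kappa<1$ and $TM=\mathbb R\xi\oplus\mathcal D_h(\lambda)\oplus\mathcal D_h(-\lambda)$, where $\mathcal D_h(\pm\lambda)$ are the eigendistributions of $h$ for $\pm\lambda$, $\lambda=\sqrt{1-\kappa}$, and $\mathcal D_h(\lambda),\mathcal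 D_h(-\lambda)=\phi(\mathcal D_h(\lambda))$ are Legendre foliations. For an operator $A$, $\mathcal D_A(c)$ denotes its eigendistribution for the eigenvalue $c$. A Legendre foliation is (the foliation defined by) an involutive rank $n$ subbundle of $\mathcal D$. "Transversal to the bi-Legendrian structure $(\mathcal D_h(\lambda),\mathcal D_h(-\lambda))$" means that each of $\mathcal D_{\phi h}(\pm\lambda)$ is transversal in $\mathcal D$ to each of $\mathcal D_h(\pm\lambda)$, i.e. $TM=\mathcal D_{\phi h}(\pm\lambda)\oplus\mathcal D_h(\pm\lambda)\oplus\mathbb R\xi$ for every choice of the two signs. *)

theory Defs
  imports "HOL-Analysis.Analysis" "HOL-Library.Function_Algebras"
begin

text \<open>Functions into a real vector space form a real vector space pointwise. Tangent vectors
  (functionals on smooth functions), vector fields and tensor fields below all use this.\<close>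

instantiation "fun" :: (type, real_vector) real_vector
begin

definition scaleR_fun_def: "c *\<^sub>R f = (\<lambda>x. c *\<^sub>R f x)"

instance
  by standard (simp_all add: scaleR_fun_def fun_eq_iff algebra_simps)

end

lemma scaleR_fun_apply [simp]: "(c *\<^sub>R f) x = c *\<^sub>R f x"
  by (simp add: scaleR_fun_def)


section \<open>Smooth manifolds\<close>

text \<open>Only used on open sets \<open>S\<close>, where it is the usual notion of a $C^k$ map.\<close>

primrec ck_on :: "nat \<Rightarrow> 'a::real_normed_vector set \<Rightarrow> ('a \<Rightarrow> 'b::real_normed_vector) \<Rightarrow> bool" where
  "ck_on 0 S f \<longleftrightarrow> continuous_on S f"
| "ck_on (Suc k) S f \<longleftrightarrow>
     (\<forall>x\<in>S. f differentiable at x) \<and> (\<forall>v. ck_on k S (\<lambda>x. frechet_derivative f (at x) v))"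

definition smooth_on :: "'a::real_normed_vector set \<Rightarrow> ('a \<Rightarrow> 'b::real_normed_vector) \<Rightarrow> bool" where
  "smooth_on S f \<longleftrightarrow> (\<forall>k. ck_on k S f)"

text \<open>The manifold is a whole Hausdorff, second countable type \<open>'a\<close>; a chart is its domain together
  with its coordinate map, and the atlas need not be maximal.\<close>

type_synonym ('a, 'e) atlas = "('a set \<times> ('a \<Rightarrow> 'e)) set"

definition smooth_atlas ::
    "('a::{t2_space,second_countable_topology}, 'e::euclidean_space) atlas \<Rightarrow> bool" where
  "smooth_atlas A \<longleftrightarrow>
     (\<forall>(U, \<psi>)\<in>A. open U \<and> open (\<psi> ` U) \<and> homeomorphism U (\<psi> ` U) \<psi> (inv_into U \<psi>)) \<and>
     (\<Union>(U, \<psi>)\<in>A. U) = UNIV \<and>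
     (\<forall>(U, \<psi>)\<in>A. \<forall>(V, \<theta>)\<in>A. smooth_on (\<psi> ` (U \<inter> V)) (\<theta> \<circ> inv_into U \<psi>))"

definition smooth_fun_on ::
    "('a::topological_space, 'e::euclidean_space) atlas \<Rightarrow> 'a set \<Rightarrow> ('a \<Rightarrow> real) \<Rightarrow> bool" where
  "smooth_fun_on A U f \<longleftrightarrow> (\<forall>(V, \<psi>)\<in>A. smooth_on (\<psi> ` (U \<inter> V)) (f \<circ> inv_into V \<psi>))"

definition smooth_funs ::
    "('a::topological_space, 'e::euclidean_space) atlas \<Rightarrow> ('a \<Rightarrow> real) set" where
  "smooth_funs A = {f. smooth_fun_on A UNIV f}"

text \<open>Tangent vectors at \<open>p\<close> are the derivations of $C^\infty(M)$ at \<open>p\<close>. They are set to \<open>0\<close> on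
  non-smooth functions, so that equality of derivations is equality of HOL functions.\<close>

type_synonym 'a tvec = "('a \<Rightarrow> real) \<Rightarrow> real"
type_synonym 'a vfield = "'a \<Rightarrow> 'a tvec"
type_synonym 'a endo_field = "'a \<Rightarrow> 'a tvec \<Rightarrow> 'a tvec"
type_synonym 'a form1 = "'a \<Rightarrow> 'a tvec \<Rightarrow> real"
type_synonym 'a form2 = "'a \<Rightarrow> 'a tvec \<Rightarrow> 'a tvec \<Rightarrow> real"
type_synonym 'a distribution = "'a \<Rightarrow> 'a tvec set"

definition tangent_space ::
    "('a::topological_space, 'e::euclidean_space) atlas \<Rightarrow> 'a distribution" where
  "tangent_space A p = {v.
     (\<forall>f. f \<notin> smooth_funs A \<longrightarrow> v f = 0) \<and>
     (\<forall>f\<in>smooth_funs A. \<forall>g\<in>smooth_funs A. v (f + g) = v f + v g) \<and>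
     (\<forall>f\<in>smooth_funs A. \<forall>c. v (c *\<^sub>R f) = c * v f) \<and>
     (\<forall>f\<in>smooth_funs A. \<forall>g\<in>smooth_funs A. v (f * g) = f p * v g + g p * v f)}"

definition vector_fields_on ::
    "('a::topological_space, 'e::euclidean_space) atlas \<Rightarrow> 'a set \<Rightarrow> 'a vfield set" where
  "vector_fields_on A U = {X. (\<forall>p\<in>U. X p \<in> tangent_space A p) \<and>
     (\<forall>f\<in>smooth_funs A. smooth_fun_on A U (\<lambda>p. X p f))}"

definition vector_fields ::
    "('a::topological_space, 'e::euclidean_space) atlas \<Rightarrow> 'a vfield set" where
  "vector_fields A = vector_fields_on A UNIV"

text \<open>The function $X(f)$.\<close>

definition deriv_along :: "'a vfield \<Rightarrow> ('a \<Rightarrow> real) \<Rightarrow> 'a \<Rightarrow> real" where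
  "deriv_along X f = (\<lambda>p. X p f)"

definition lie_bracket :: "'a vfield \<Rightarrow> 'a vfield \<Rightarrow> 'a vfield" where
  "lie_bracket X Y = (\<lambda>p f. X p (deriv_along Y f) - Y p (deriv_along X f))"

definition fsmul :: "('a \<Rightarrow> real) \<Rightarrow> 'a vfield \<Rightarrow> 'a vfield" (infixr "\<odot>" 75) where
  "f \<odot> X = (\<lambda>p. f p *\<^sub>R X p)"


section \<open>Tensor fields\<close>

definition linear_map_on :: "'v::real_vector set \<Rightarrow> ('v \<Rightarrow> 'w::real_vector) \<Rightarrow> bool" where
  "linear_map_on V L \<longleftrightarrow>
     (\<forall>v\<in>V. \<forall>w\<in>V. L (v + w) = L v + L w) \<and> (\<forall>v\<in>V. \<forall>c. L (c *\<^sub>R v) = c *\<^sub>R L v)"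

text \<open>\<open>app \<phi> X\<close> is $\phi X$ for an endomorphism field, and $\eta(X)$ for a 1-form.\<close>

definition app :: "('a \<Rightarrow> 'v \<Rightarrow> 'w) \<Rightarrow> ('a \<Rightarrow> 'v) \<Rightarrow> 'a \<Rightarrow> 'w" where
  "app T X = (\<lambda>p. T p (X p))"

definition app2 :: "'a form2 \<Rightarrow> 'a vfield \<Rightarrow> 'a vfield \<Rightarrow> 'a \<Rightarrow> real" where
  "app2 g X Y = (\<lambda>p. g p (X p) (Y p))"

definition smooth_endo_field ::
    "('a::topological_space, 'e::euclidean_space) atlas \<Rightarrow> 'a endo_field \<Rightarrow> bool" where
  "smooth_endo_field A \<phi> \<longleftrightarrow>
     (\<forall>p. linear_map_on (tangent_space A p) (\<phi> p) \<and> \<phi> p ` tangent_space A p \<subseteq> tangent_space A p) \<and>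
     (\<forall>X\<in>vector_fields A. app \<phi> X \<in> vector_fields A)"

definition smooth_one_form ::
    "('a::topological_space, 'e::euclidean_space) atlas \<Rightarrow> 'a form1 \<Rightarrow> bool" where
  "smooth_one_form A \<eta> \<longleftrightarrow>
     (\<forall>p. linear_map_on (tangent_space A p) (\<eta> p)) \<and>
     (\<forall>X\<in>vector_fields A. app \<eta> X \<in> smooth_funs A)"

definition riemannian_metric ::
    "('a::topological_space, 'e::euclidean_space) atlas \<Rightarrow> 'a form2 \<Rightarrow> bool" where
  "riemannian_metric A g \<longleftrightarrow>
     (\<forall>p. \<forall>v\<in>tangent_space A p. linear_map_on (tangent_space A p) (g p v)) \<and>
     (\<forall>p. \<forall>v\<in>tangent_space A p. \<forall>w\<in>tangent_space A p. g p v w = g p w v) \<and>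
     (\<forall>p. \<forall>v\<in>tangent_space A p. v \<noteq> 0 \<longrightarrow> 0 < g p v v) \<and>
     (\<forall>X\<in>vector_fields A. \<forall>Y\<in>vector_fields A. app2 g X Y \<in> smooth_funs A)"

text \<open>Exterior derivative of a 1-form, normalised with the factor $1/2$.\<close>

definition ext_deriv :: "'a form1 \<Rightarrow> 'a vfield \<Rightarrow> 'a vfield \<Rightarrow> 'a \<Rightarrow> real" where
  "ext_deriv \<eta> X Y = (1/2) *\<^sub>R
     (deriv_along X (app \<eta> Y) - deriv_along Y (app \<eta> X) - app \<eta> (lie_bracket X Y))"

text \<open>$(\mathcal L_\xi\phi)X = [\xi,\phi X]-\phi[\xi,X]$ is $C^\infty(M)$-linear in \<open>X\<close>, so its value at
  \<open>p\<close> depends only on the tangent vector \<open>X p\<close>; this common value is the endomorphism at \<open>p\<close>.\<close>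

definition lie_deriv_endo ::
    "('a::topological_space, 'e::euclidean_space) atlas \<Rightarrow> 'a vfield \<Rightarrow> 'a endo_field \<Rightarrow> 'a endo_field"
  where
  "lie_deriv_endo A \<xi> \<phi> p v = (THE w. \<forall>X\<in>vector_fields A. X p = v \<longrightarrow>
     w = (lie_bracket \<xi> (app \<phi> X) - app \<phi> (lie_bracket \<xi> X)) p)"

definition nijenhuis :: "'a endo_field \<Rightarrow> 'a vfield \<Rightarrow> 'a vfield \<Rightarrow> 'a vfield" where
  "nijenhuis \<phi> X Y = app \<phi> (app \<phi> (lie_bracket X Y)) + lie_bracket (app \<phi> X) (app \<phi> Y)
     - app \<phi> (lie_bracket (app \<phi> X) Y) - app \<phi> (lie_bracket X (app \<phi> Y))"

definition levi_civita ::
    "('a::topological_space, 'e::euclidean_space) atlas \<Rightarrow> 'a form2 \<Rightarrow>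
     ('a vfield \<Rightarrow> 'a vfield \<Rightarrow> 'a vfield) \<Rightarrow> bool" where
  "levi_civita A g nabla \<longleftrightarrow>
     (\<forall>X\<in>vector_fields A. \<forall>Y\<in>vector_fields A. \<forall>Z\<in>vector_fields A. \<forall>f\<in>smooth_funs A.
        nabla X Y \<in> vector_fields A \<and>
        nabla (X + Y) Z = nabla X Z + nabla Y Z \<and>
        nabla (f \<odot> X) Y = f \<odot> nabla X Y \<and>
        nabla X (Y + Z) = nabla X Y + nabla X Z \<and>
        nabla X (f \<odot> Y) = deriv_along X f \<odot> Y + f \<odot> nabla X Y \<and>
        nabla X Y - nabla Y X = lie_bracket X Y \<and>
        deriv_along X (app2 g Y Z) = app2 g (nabla X Y) Z + app2 g Y (nabla X Z))"

definition curvature ::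
    "('a vfield \<Rightarrow> 'a vfield \<Rightarrow> 'a vfield) \<Rightarrow> 'a vfield \<Rightarrow> 'a vfield \<Rightarrow> 'a vfield \<Rightarrow> 'a vfield" where
  "curvature nabla X Y Z = nabla X (nabla Y Z) - nabla Y (nabla X Z) - nabla (lie_bracket X Y) Z"


section \<open>Contact metric manifolds\<close>

definition contact_metric_manifold ::
    "('a::{t2_space,second_countable_topology}, 'e::euclidean_space) atlas \<Rightarrow> nat \<Rightarrow>
     'a endo_field \<Rightarrow> 'a vfield \<Rightarrow> 'a form1 \<Rightarrow> 'a form2 \<Rightarrow> bool" where
  "contact_metric_manifold A n \<phi> \<xi> \<eta> g \<longleftrightarrow>
     smooth_atlas A \<and> DIM('e) = 2 * n + 1 \<and>
     smooth_endo_field A \<phi> \<and> \<xi> \<in> vector_fields A \<and> smooth_one_form A \<eta> \<and> riemannian_metric A g \<and>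
     (\<forall>p. \<forall>v\<in>tangent_space A p. \<phi> p (\<phi> p v) = - v + \<eta> p v *\<^sub>R \<xi> p) \<and>
     (\<forall>p. \<eta> p (\<xi> p) = 1) \<and>
     (\<forall>p. \<forall>v\<in>tangent_space A p. \<forall>w\<in>tangent_space A p.
        g p (\<phi> p v) (\<phi> p w) = g p v w - \<eta> p v * \<eta> p w) \<and>
     (\<forall>X\<in>vector_fields A. \<forall>Y\<in>vector_fields A. ext_deriv \<eta> X Y = app2 g X (app \<phi> Y))"

definition sasakian ::
    "('a::{t2_space,second_countable_topology}, 'e::euclidean_space) atlas \<Rightarrow> nat \<Rightarrow>
     'a endo_field \<Rightarrow> 'a vfield \<Rightarrow> 'a form1 \<Rightarrow> 'a form2 \<Rightarrow> bool" where
  "sasakian A n \<phi> \<xi> \<eta> g \<longleftrightarrow> contact_metric_manifold A n \<phi> \<xi> \<eta> g \<and>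
     (\<forall>X\<in>vector_fields A. \<forall>Y\<in>vector_fields A.
        nijenhuis \<phi> X Y + (2 *\<^sub>R ext_deriv \<eta> X Y) \<odot> \<xi> = 0)"

definition contact_h ::
    "('a::topological_space, 'e::euclidean_space) atlas \<Rightarrow> 'a endo_field \<Rightarrow> 'a vfield \<Rightarrow> 'a endo_field"
  where
  "contact_h A \<phi> \<xi> = (1/2) *\<^sub>R lie_deriv_endo A \<xi> \<phi>"

text \<open>The Levi-Civita connection is unique on smooth vector fields, but as a HOL function it is
  unconstrained elsewhere; hence it is quantified rather than described.\<close>

definition kappa_mu_manifold ::
    "('a::{t2_space,second_countable_topology}, 'e::euclidean_space) atlas \<Rightarrow> nat \<Rightarrow>
     'a endo_field \<Rightarrow> 'a vfield \<Rightarrow> 'a form1 \<Rightarrow> 'a form2 \<Rightarrow> real \<Rightarrow> real \<Rightarrow> bool" where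
  "kappa_mu_manifold A n \<phi> \<xi> \<eta> g \<kappa> \<mu> \<longleftrightarrow> contact_metric_manifold A n \<phi> \<xi> \<eta> g \<and>
     (\<exists>nabla. levi_civita A g nabla \<and>
       (\<forall>X\<in>vector_fields A. \<forall>Y\<in>vector_fields A.
          curvature nabla X Y \<xi> =
            \<kappa> *\<^sub>R (app \<eta> Y \<odot> X - app \<eta> X \<odot> Y) +
            \<mu> *\<^sub>R (app \<eta> Y \<odot> app (contact_h A \<phi> \<xi>) X - app \<eta> X \<odot> app (contact_h A \<phi> \<xi>) Y)))"


section \<open>Distributions\<close>

definition eigenvalues_at ::
    "('a::topological_space, 'e::euclidean_space) atlas \<Rightarrow> 'a endo_field \<Rightarrow> 'a \<Rightarrow> real set" where
  "eigenvalues_at A T p = {c. \<exists>v\<in>tangent_space A p. v \<noteq> 0 \<and> T p v = c *\<^sub>R v}"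

definition eigendistribution ::
    "('a::topological_space, 'e::euclidean_space) atlas \<Rightarrow> 'a endo_field \<Rightarrow> real \<Rightarrow> 'a distribution"
  where
  "eigendistribution A T c = (\<lambda>p. {v \<in> tangent_space A p. T p v = c *\<^sub>R v})"

definition sections ::
    "('a::topological_space, 'e::euclidean_space) atlas \<Rightarrow> 'a distribution \<Rightarrow> 'a vfield set" where
  "sections A D = {X \<in> vector_fields A. \<forall>p. X p \<in> D p}"

text \<open>Rank \<open>k\<close> subbundle of the tangent bundle, smoothness being expressed by local frames.\<close>

definition subbundle ::
    "('a::topological_space, 'e::euclidean_space) atlas \<Rightarrow> nat \<Rightarrow> 'a distribution \<Rightarrow> bool" where
  "subbundle A k D \<longleftrightarrow>
     (\<forall>p. subspace (D p) \<and> D p \<subseteq> tangent_space A p \<and> dim (D p) = k) \<and>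
     (\<forall>p. \<exists>U E. open U \<and> p \<in> U \<and> (\<forall>i<k. E i \<in> vector_fields_on A U) \<and>
        (\<forall>q\<in>U. D q = span ((\<lambda>i. E i q) ` {..<k})))"

definition involutive ::
    "('a::topological_space, 'e::euclidean_space) atlas \<Rightarrow> 'a distribution \<Rightarrow> bool" where
  "involutive A D \<longleftrightarrow> (\<forall>X\<in>sections A D. \<forall>Y\<in>sections A D. lie_bracket X Y \<in> sections A D)"

definition legendre_foliation ::
    "('a::topological_space, 'e::euclidean_space) atlas \<Rightarrow> nat \<Rightarrow> 'a form1 \<Rightarrow> 'a distribution \<Rightarrow> bool"
  where
  "legendre_foliation A n \<eta> D \<longleftrightarrow>
     subbundle A n D \<and> involutive A D \<and> (\<forall>p. \<forall>v\<in>D p. \<eta> p v = 0)"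

definition mutually_orthogonal :: "'a form2 \<Rightarrow> 'a distribution \<Rightarrow> 'a distribution \<Rightarrow> bool" where
  "mutually_orthogonal g D E \<longleftrightarrow> (\<forall>p. \<forall>v\<in>D p. \<forall>w\<in>E p. g p v w = 0)"

text \<open>\<open>V\<close> is the internal direct sum of its subspaces \<open>P\<close>, \<open>Q\<close> and \<open>R\<close>.\<close>

definition direct_sum3 ::
    "'v::real_vector set \<Rightarrow> 'v set \<Rightarrow> 'v set \<Rightarrow> 'v set \<Rightarrow> bool" where
  "direct_sum3 V P Q R \<longleftrightarrow>
     subspace P \<and> subspace Q \<and> subspace R \<and> P \<subseteq> V \<and> Q \<subseteq> V \<and> R \<subseteq> V \<and>
     (\<forall>v\<in>V. \<exists>!(x, y, z). x \<in> P \<and> y \<in> Q \<and> z \<in> R \<and> v = x + y + z)"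

definition transversal ::
    "('a::topological_space, 'e::euclidean_space) atlas \<Rightarrow> 'a vfield \<Rightarrow>
     'a distribution \<Rightarrow> 'a distribution \<Rightarrow> bool" where
  "transversal A \<xi> D E \<longleftrightarrow> (\<forall>p. direct_sum3 (tangent_space A p) (D p) (E p) (span {\<xi> p}))"

end

theory Submission
  imports Defs
begin

text \<open>
Write $-\nabla\xi = \phi + P$. The equation $d\eta(X,Y) = g(X,\phi Y)$ says that the antisymmetric part of
$-\nabla\xi$ is $\phi$, so \<open>P\<close> is symmetric. Closedness of $d\eta$ gives $\nabla_\xi\phi = P\phi + \phi P$;
since $\nabla_\xi\phi$ also anticommutes with $\phi$, both sides vanish (\<open>phi_P\<close>). Hence
$h = P\phi$ and $\phi h = P$ (\<open>contact_h_at\<close>, \<open>phi_contact_h_at\<close>): the operator of the theorem is the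
symmetric part of $-\nabla\xi$, and it anticommutes with $\phi$.

The nullity condition for $R(X,\xi)\xi$, added to its conjugate by $\phi$, becomes
$P^2 = (\kappa-1)\phi^2$ (\<open>P_P\<close>). If \<open>P\<close> vanished identically, the nullity condition would determine
$\nabla\phi$ and the manifold would be Sasakian (\<open>sasakian_if_P_zero\<close>). So $\kappa < 1$, and on
$\ker\eta$ the operator $P/\lambda$ is an involution anticommuting with $\phi$. The eigenvalues, the
multiplicities, the description of the eigenspaces of $\phi h$ by those of \<open>h\<close>, and transversality are then
linear algebra in one tangent space, carried out in the locale \<open>contact_vector_space\<close>. Orthogonality is
symmetry of \<open>P\<close>.

Involutivity (\<open>eigenfields_involutive\<close>) comes from the nullity condition for $R(X,Y)\xi$ with \<open>X\<close>, \<open>Y\<close>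
orthogonal to $\xi$, where it says that $(\nabla_X(\phi + P))Y$ is symmetric in \<open>X\<close> and \<open>Y\<close>. By
closedness of $d\eta$ this means
$g((\nabla_X P)Y - (\nabla_Y P)X, Z) = g((\nabla_Z\phi)X, Y)$. For \<open>X\<close>, \<open>Y\<close>, \<open>Z\<close> in the same
eigendistribution of \<open>P\<close> the left-hand side vanishes; since $g((\nabla_Z\phi)X,Y)$ changes sign under
$(X,Y)\mapsto(\phi X,\phi Y)$ for \<open>X\<close>, \<open>Y\<close> orthogonal to $\xi$, it also vanishes for \<open>X\<close>, \<open>Y\<close> in one
eigendistribution and \<open>Z\<close> in the opposite one. There the left-hand side is a nonzero multiple of
$g([X,Y],Z)$.

All of this is a computation with global vector fields. It descends to tangent vectors because each tangent
vector extends to a global vector field (\<open>tangent_vector_extension\<close>), and dimensions can be counted because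
the derivations at a point form a space of the dimension of the model space
(\<open>tangent_space_coordinates\<close>). Both rest on bump functions and Hadamard's lemma. Smoothness of the
eigendistributions follows by projecting extended vectors to eigenfields (\<open>subbundleI\<close>, \<open>legendre_D\<close>).
\<close>


section \<open>Differentiable functions of several variables\<close>

lemma ck_on_subset: "ck_on k S f \<Longrightarrow> T \<subseteq> S \<Longrightarrow> ck_on k T f"
  by (induction k arbitrary: f) (auto intro: continuous_on_subset)

lemma ck_on_SucD: "ck_on (Suc k) S f \<Longrightarrow> ck_on k S f"
proof (induction k arbitrary: f)
  case 0
  then show ?case
    by (auto intro!: continuous_at_imp_continuous_on differentiable_imp_continuous_within)
next
  case (Suc k)
  then show ?case by (metis ck_on.simps(2))
qed

lemma ck_on_cong:
  assumes "open S" "\<And>x. x \<in> S \<Longrightarrow> f x = g x" "ck_on k S f"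
  shows "ck_on k S g"
  using assms(2,3)
proof (induction k arbitrary: f g)
  case 0
  then show ?case by (metis (no_types, lifting) ck_on.simps(1) continuous_on_cong)
next
  case (Suc k)
  have d: "(g has_derivative frechet_derivative f (at x)) (at x)" if "x \<in> S" for x
    using has_derivative_transform_within_open[OF _ \<open>open S\<close> that Suc.prems(1)] Suc.prems(2) that
    by (auto simp: frechet_derivative_works)
  have e: "frechet_derivative f (at x) v = frechet_derivative g (at x) v" if "x \<in> S" for x v
    using frechet_derivative_at[OF d[OF that]] by simp
  have "ck_on k S (\<lambda>x. frechet_derivative g (at x) v)" for v
    by (rule Suc.IH[OF e]) (use Suc.prems in auto)
  then show ?case using d by (auto simp: differentiable_def)
qed

lemma ck_on_SucI:
  assumes "open S" "\<And>x. x \<in> S \<Longrightarrow> (f has_derivative f' x) (at x)"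
    and "\<And>v. ck_on k S (\<lambda>x. f' x v)"
  shows "ck_on (Suc k) S f"
proof -
  have "f' x v = frechet_derivative f (at x) v" if "x \<in> S" for x v
    using frechet_derivative_at[OF assms(2)[OF that]] by simp
  then have "ck_on k S (\<lambda>x. frechet_derivative f (at x) v)" for v
    by (rule ck_on_cong[OF assms(1) _ assms(3)])
  then show ?thesis using assms(2) by (auto simp: differentiable_def)
qed

lemma ck_on_has_derivative:
  "ck_on (Suc k) S f \<Longrightarrow> x \<in> S \<Longrightarrow> (f has_derivative frechet_derivative f (at x)) (at x)"
  by (auto simp: frechet_derivative_works)

lemma ck_on_Un:
  assumes "open S" "open T" "ck_on k S f" "ck_on k T f"
  shows "ck_on k (S \<union> T) f"
  using assms(3,4) by (induction k arbitrary: f) (auto intro!: continuous_on_open_Un assms)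

lemma ck_on_const: "ck_on k S (\<lambda>x. c)"
  by (induction k arbitrary: c) auto

lemma ck_on_add:
  assumes "open S" "ck_on k S f" "ck_on k S g"
  shows "ck_on k S (\<lambda>x. f x + g x)"
  using assms(2,3)
proof (induction k arbitrary: f g)
  case 0 then show ?case by (auto intro: continuous_intros)
next
  case (Suc k)
  show ?case
    by (rule ck_on_SucI[OF assms(1) has_derivative_add[OF ck_on_has_derivative ck_on_has_derivative]])
       (use Suc in auto)
qed

lemma ck_on_sum:
  assumes "open S" "\<And>i. i \<in> I \<Longrightarrow> ck_on k S (f i)"
  shows "ck_on k S (\<lambda>x. \<Sum>i\<in>I. f i x)"
  using assms(2)
  by (induction I rule: infinite_finite_induct) (auto intro: ck_on_const ck_on_add assms(1))

lemma ck_on_bounded_linear_compose: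
  assumes "open S" "bounded_linear L" "ck_on k S f"
  shows "ck_on k S (\<lambda>x. L (f x))"
  using assms(3)
proof (induction k arbitrary: f)
  case 0 then show ?case using bounded_linear.continuous_on[OF assms(2)] by auto
next
  case (Suc k)
  show ?case
    by (rule ck_on_SucI[OF assms(1) bounded_linear.has_derivative[OF assms(2) ck_on_has_derivative]])
       (use Suc in auto)
qed

lemma ck_on_bounded_linear:
  assumes "open S" "bounded_linear L"
  shows "ck_on k S L"
proof (cases k)
  case 0 then show ?thesis using assms(2) by (auto intro: linear_continuous_on)
next
  case (Suc j)
  show ?thesis unfolding Suc
    by (rule ck_on_SucI[OF assms(1) bounded_linear_imp_has_derivative[OF assms(2)]])
       (rule ck_on_const)
qed

lemma ck_on_scaleR:
  assumes "open S" "ck_on k S f" "ck_on k S g"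
  shows "ck_on k S (\<lambda>x. f x *\<^sub>R g x)"
  using assms(2,3)
proof (induction k arbitrary: f g)
  case 0 then show ?case by (auto intro: continuous_intros)
next
  case (Suc k)
  show ?case
  proof (rule ck_on_SucI[OF assms(1) has_derivative_scaleR[OF ck_on_has_derivative ck_on_has_derivative]])
    fix v
    show "ck_on k S (\<lambda>x. f x *\<^sub>R frechet_derivative g (at x) v + frechet_derivative f (at x) v *\<^sub>R g x)"
      by (intro ck_on_add Suc.IH assms(1)) (use Suc.prems ck_on_SucD in auto)
  qed (use Suc in auto)
qed

lemma ck_on_mult:
  fixes f g :: "'a::real_normed_vector \<Rightarrow> real"
  shows "open S \<Longrightarrow> ck_on k S f \<Longrightarrow> ck_on k S g \<Longrightarrow> ck_on k S (\<lambda>x. f x * g x)"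
  using ck_on_scaleR[of S k f g] by simp

text \<open>The derivative at \<open>g x\<close> in the moving direction \<open>Dg x v\<close> is expanded in the fixed basis of the
  middle space, so that the induction hypothesis applies to each partial derivative of the outer map.\<close>

lemma ck_on_compose:
  fixes g :: "'a::real_normed_vector \<Rightarrow> 'b::euclidean_space" and f :: "'b \<Rightarrow> 'c::real_normed_vector"
  assumes "open S" "open T" "g ` S \<subseteq> T" "ck_on k S g" "ck_on k T f"
  shows "ck_on k S (\<lambda>x. f (g x))"
  using assms(4,5)
proof (induction k arbitrary: f)
  case 0 then show ?case using assms(3) by (auto intro: continuous_on_compose2)
next
  case (Suc k)
  let ?dg = "\<lambda>x. frechet_derivative g (at x)" and ?df = "\<lambda>y. frechet_derivative f (at y)"
  show ?case
  proof (rule ck_on_SucI[OF assms(1), where f' = "\<lambda>x v. \<Sum>b\<in>Basis. (?dg x v \<bullet> b) *\<^sub>R ?df (g x) b"])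
    fix x assume x: "x \<in> S"
    have df: "(f has_derivative ?df (g x)) (at (g x))"
      by (rule ck_on_has_derivative[OF Suc.prems(2)]) (use x assms(3) in auto)
    interpret linear "?df (g x)" using df has_derivative_linear by blast
    have "?df (g x) (?dg x v) = (\<Sum>b\<in>Basis. (?dg x v \<bullet> b) *\<^sub>R ?df (g x) b)" for v
      by (subst (1) euclidean_representation[of "?dg x v", symmetric]) (simp add: sum scale)
    moreover have "(f \<circ> g has_derivative ?df (g x) \<circ> ?dg x) (at x)"
      by (rule diff_chain_at[OF ck_on_has_derivative[OF Suc.prems(1) x] df])
    ultimately show "((\<lambda>x. f (g x)) has_derivative (\<lambda>v. \<Sum>b\<in>Basis. (?dg x v \<bullet> b) *\<^sub>R ?df (g x) b)) (at x)"
      by (simp add: o_def)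
  next
    fix v
    show "ck_on k S (\<lambda>x. \<Sum>b\<in>Basis. (?dg x v \<bullet> b) *\<^sub>R ?df (g x) b)"
      by (intro ck_on_sum ck_on_scaleR ck_on_bounded_linear_compose[OF _ bounded_linear_inner_left]
            Suc.IH assms(1)) (use Suc.prems ck_on_SucD in auto)
  qed
qed

lemma smooth_on_frechet_derivative: "smooth_on S f \<Longrightarrow> smooth_on S (\<lambda>x. frechet_derivative f (at x) v)"
  unfolding smooth_on_def by (metis ck_on.simps(2))

lemma smooth_on_has_derivative:
  "smooth_on S f \<Longrightarrow> x \<in> S \<Longrightarrow> (f has_derivative frechet_derivative f (at x)) (at x)"
  unfolding smooth_on_def using ck_on_has_derivative by blast

lemma smooth_on_continuous_on: "smooth_on S f \<Longrightarrow> continuous_on S f"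
  unfolding smooth_on_def by (metis ck_on.simps(1))

lemma smooth_on_subset: "smooth_on S f \<Longrightarrow> T \<subseteq> S \<Longrightarrow> smooth_on T f"
  unfolding smooth_on_def using ck_on_subset by blast

lemma smooth_on_cong: "open S \<Longrightarrow> (\<And>x. x \<in> S \<Longrightarrow> f x = g x) \<Longrightarrow> smooth_on S f \<Longrightarrow> smooth_on S g"
  unfolding smooth_on_def using ck_on_cong by blast

lemma smooth_on_Un: "open S \<Longrightarrow> open T \<Longrightarrow> smooth_on S f \<Longrightarrow> smooth_on T f \<Longrightarrow> smooth_on (S \<union> T) f"
  unfolding smooth_on_def using ck_on_Un by blast

lemma smooth_on_const: "smooth_on S (\<lambda>x. c)"
  unfolding smooth_on_def using ck_on_const by blast

lemma smooth_on_add: "open S \<Longrightarrow> smooth_on S f \<Longrightarrow> smooth_on S g \<Longrightarrow> smooth_on S (\<lambda>x. f x + g x)"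
  unfolding smooth_on_def using ck_on_add by blast

lemma smooth_on_mult:
  fixes f g :: "'a::real_normed_vector \<Rightarrow> real"
  shows "open S \<Longrightarrow> smooth_on S f \<Longrightarrow> smooth_on S g \<Longrightarrow> smooth_on S (\<lambda>x. f x * g x)"
  unfolding smooth_on_def using ck_on_mult by blast

lemma smooth_on_bounded_linear: "open S \<Longrightarrow> bounded_linear L \<Longrightarrow> smooth_on S L"
  unfolding smooth_on_def using ck_on_bounded_linear by blast

lemma smooth_on_compose:
  fixes g :: "'a::real_normed_vector \<Rightarrow> 'b::euclidean_space" and f :: "'b \<Rightarrow> 'c::real_normed_vector"
  shows "open S \<Longrightarrow> open T \<Longrightarrow> g ` S \<subseteq> T \<Longrightarrow> smooth_on S g \<Longrightarrow> smooth_on T f \<Longrightarrow> smooth_on S (\<lambda>x. f (g x))"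
  unfolding smooth_on_def using ck_on_compose by blast


section \<open>Bump functions\<close>

text \<open>The functions $e^{-1/t}/t^j$, extended by \<open>0\<close>: the family is closed under differentiation,
  up to linear combinations, and this is what makes $e^{-1/t}$ smooth at \<open>0\<close>.\<close>

definition flat :: "nat \<Rightarrow> real \<Rightarrow> real" where
  "flat j t = (if 0 < t then exp (- (1/t)) / t ^ j else 0)"

lemma flat_tendsto_0: "(flat j \<longlongrightarrow> 0) (at 0)"
proof -
  have "((\<lambda>t::real. (inverse t) ^ j / exp (inverse t)) \<longlongrightarrow> 0) (at_right 0)"
    by (rule filterlim_compose[OF tendsto_power_div_exp_0 filterlim_inverse_at_top_right])
  moreover have "\<forall>\<^sub>F t::real in at_right 0. (inverse t) ^ j / exp (inverse t) = flat j t"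
    by (auto simp: eventually_at_right_field flat_def exp_minus field_simps power_inverse intro!: exI[of _ 1])
  ultimately have "(flat j \<longlongrightarrow> 0) (at_right 0)"
    by (rule Lim_transform_eventually)
  moreover have "\<forall>\<^sub>F t::real in at_left 0. 0 = flat j t"
    by (auto simp: eventually_at_left_field flat_def intro!: exI[of _ "-1"])
  then have "(flat j \<longlongrightarrow> 0) (at_left 0)"
    by (rule Lim_transform_eventually[rotated]) simp
  ultimately show ?thesis by (simp add: filterlim_at_split)
qed

lemma flat_has_derivative:
  "(flat j has_real_derivative flat (j + 2) t - real j * flat (j + 1) t) (at t)"
proof (cases t "0::real" rule: linorder_cases)
  case less
  have "(flat j has_real_derivative 0) (at t)"
    by (rule has_field_derivative_transform_within_open[where f = "\<lambda>_. 0" and S = "{..<0}"])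
       (use less in \<open>auto simp: flat_def\<close>)
  then show ?thesis using less by (simp add: flat_def)
next
  case equal
  have "flat j h / h = flat (j + 1) h" for h by (simp add: flat_def)
  then have "((\<lambda>h. (flat j (0 + h) - flat j 0) / h) \<longlongrightarrow> 0) (at 0)"
    using flat_tendsto_0[of "j+1"] by (simp add: flat_def[of _ 0])
  then show ?thesis using equal by (simp add: DERIV_def flat_def[of _ 0])
next
  case greater
  have "((\<lambda>t. exp (- (1/t)) / t ^ j) has_real_derivative flat (j + 2) t - real j * flat (j + 1) t) (at t)"
    by (rule derivative_eq_intros refl | use greater in \<open>simp; fail\<close>)+
       (use greater in \<open>cases j; simp add: flat_def field_simps power_add power2_eq_square\<close>)
  then show ?thesis
    by (rule has_field_derivative_transform_within_open[where S = "{0<..}"])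
       (use greater in \<open>auto simp: flat_def\<close>)
qed

lemma smooth_on_flat: "smooth_on UNIV (flat j)"
proof -
  have "ck_on k UNIV (flat j)" for k j
  proof (induction k arbitrary: j)
    case 0
    then show ?case
      using flat_has_derivative by (auto intro!: continuous_at_imp_continuous_on DERIV_isCont)
  next
    case (Suc k)
    have d: "(flat j has_derivative (\<lambda>v. (flat (j + 2) t - real j * flat (j + 1) t) * v)) (at t)" for t
      using flat_has_derivative[of j t] by (simp add: has_field_derivative_def)
    show ?case
    proof (rule ck_on_SucI[OF open_UNIV d])
      fix v
      have "ck_on k UNIV (\<lambda>t. (flat (j + 2) t + (- real j) * flat (j + 1) t) * v)"
        by (intro ck_on_mult ck_on_add Suc.IH ck_on_const open_UNIV)
      then show "ck_on k UNIV (\<lambda>t. (flat (j + 2) t - real j * flat (j + 1) t) * v)" by simp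
    qed
  qed
  then show ?thesis by (simp add: smooth_on_def)
qed

text \<open>The bump is $e^{1/r^2} e^{-1/q}$ with $q = r^2 - |x-a|^2$. Its derivative vanishes at \<open>a\<close> because
  \<open>a\<close> is a critical point of \<open>q\<close>.\<close>

lemma bump_exists:
  fixes a :: "'e::euclidean_space"
  assumes "0 < r"
  obtains \<beta> :: "'e \<Rightarrow> real" where "smooth_on UNIV \<beta>" "\<beta> a = 1" "(\<beta> has_derivative (\<lambda>_. 0)) (at a)"
    "\<And>x. x \<notin> cball a r \<Longrightarrow> \<beta> x = 0"
proof
  define q where "q x = r\<^sup>2 - (x - a) \<bullet> (x - a)" for x
  let ?\<beta> = "\<lambda>x. exp (1 / r\<^sup>2) * flat 0 (q x)"
  have "(x - a) \<bullet> (x - a) = (\<Sum>b\<in>Basis. (x \<bullet> b + - (a \<bullet> b)) * (x \<bullet> b + - (a \<bullet> b)))" for x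
    by (subst euclidean_inner) (simp add: inner_diff_left)
  then have q: "q = (\<lambda>x. r\<^sup>2 + (\<Sum>b\<in>Basis. (-1) * ((x \<bullet> b + - (a \<bullet> b)) * (x \<bullet> b + - (a \<bullet> b)))))"
    by (simp add: q_def fun_eq_iff sum_negf)
  have "smooth_on UNIV q"
    unfolding q smooth_on_def
    by (intro allI ck_on_add ck_on_sum ck_on_mult ck_on_const open_UNIV
          ck_on_bounded_linear[OF open_UNIV bounded_linear_inner_left])
  then show "smooth_on UNIV ?\<beta>"
    by (intro smooth_on_mult smooth_on_const open_UNIV smooth_on_compose[OF _ _ _ _ smooth_on_flat]) auto
  show "?\<beta> a = 1" using assms by (simp add: q_def flat_def exp_minus)
  have dq: "(q has_derivative (\<lambda>_. 0)) (at a)"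
    unfolding q_def by (auto intro!: derivative_eq_intros)
  have df: "(flat 0 has_derivative (\<lambda>v. flat 2 (q a) * v)) (at (q a))"
    using flat_has_derivative[of 0 "q a"] by (simp add: has_field_derivative_def numeral_2_eq_2)
  show "(?\<beta> has_derivative (\<lambda>_. 0)) (at a)"
    using has_derivative_mult_right[OF has_derivative_compose[OF dq df], of "exp (1 / r\<^sup>2)"] by simp
  fix x assume "x \<notin> cball a r"
  then have "r\<^sup>2 < (norm (x - a))\<^sup>2" using assms by (auto simp: dist_norm norm_minus_commute intro!: power_strict_mono)
  then show "?\<beta> x = 0" by (simp add: q_def flat_def dot_square_norm)
qed


section \<open>Hadamard's lemma\<close>

text \<open>Differentiation under the integral sign in the direction \<open>b\<close> replaces \<open>F\<close> by its partial derivative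
  and produces a factor \<open>t\<close>; with the weight \<open>t ^ m\<close> the family of these integrals is closed under this.\<close>

lemma smooth_segment_mean:
  fixes F :: "'e::euclidean_space \<Rightarrow> real"
  assumes "smooth_on UNIV F"
  shows "smooth_on UNIV (\<lambda>x. integral {0..1} (\<lambda>t. t ^ m * F (a + t *\<^sub>R (x - a))))"
proof -
  have "ck_on k UNIV (\<lambda>x. integral (cbox 0 1) (\<lambda>t::real. t ^ m * F (a + t *\<^sub>R (x - a))))"
    if "smooth_on UNIV F" for k m and F :: "'e \<Rightarrow> real"
    using that
  proof (induction k arbitrary: m F)
    case 0
    have cF: "continuous_on UNIV F" by (rule smooth_on_continuous_on[OF 0])
    have "continuous_on (UNIV \<times> cbox 0 1) (\<lambda>(x, t). t ^ m * F (a + t *\<^sub>R (x - a)))"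
      by (auto simp: case_prod_beta intro!: continuous_intros continuous_on_compose2[OF cF])
    then show ?case by (simp only: ck_on.simps) (rule integral_continuous_on_param)
  next
    case (Suc k)
    let ?dF = "\<lambda>b y. frechet_derivative F (at y) b"
    have sd: "smooth_on UNIV (?dF b)" for b by (rule smooth_on_frechet_derivative[OF Suc.prems])
    have cF: "continuous_on UNIV F" by (rule smooth_on_continuous_on[OF Suc.prems])
    have cd: "continuous_on UNIV (?dF b)" for b by (rule smooth_on_continuous_on[OF sd])
    define D :: "'e \<Rightarrow> real \<Rightarrow> 'e \<Rightarrow>\<^sub>L real" where
      "D x t = (\<Sum>b\<in>Basis. (t ^ Suc m * ?dF b (a + t *\<^sub>R (x - a))) *\<^sub>R blinfun_inner_left b)" for x t
    have D_apply: "blinfun_apply (D x t) v = t ^ m * frechet_derivative F (at (a + t *\<^sub>R (x - a))) (t *\<^sub>R v)" for x t v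
    proof -
      let ?y = "a + t *\<^sub>R (x - a)"
      interpret linear "frechet_derivative F (at ?y)"
        using smooth_on_has_derivative[OF Suc.prems] has_derivative_linear by blast
      have "frechet_derivative F (at ?y) v = (\<Sum>b\<in>Basis. (v \<bullet> b) * ?dF b ?y)"
        by (subst (1) euclidean_representation[of v, symmetric]) (simp add: sum scale)
      then show ?thesis
        by (simp add: D_def blinfun.sum_left blinfun.scaleR_left scale sum_distrib_left mult_ac)
    qed
    have der: "((\<lambda>x. t ^ m * F (a + t *\<^sub>R (x - a))) has_derivative blinfun_apply (D x t)) (at x)" for x t
    proof -
      have "((\<lambda>x. F (a + t *\<^sub>R (x - a))) has_derivative (\<lambda>v. frechet_derivative F (at (a + t *\<^sub>R (x - a))) (t *\<^sub>R v))) (at x)"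
        by (rule has_derivative_compose[OF _ smooth_on_has_derivative[OF Suc.prems]])
           (auto intro!: derivative_eq_intros)
      from has_derivative_mult_right[OF this, of "t ^ m"] show ?thesis
        by (simp add: D_apply[abs_def])
    qed
    have cD: "continuous_on (UNIV \<times> cbox 0 1) (\<lambda>(x, t). D x t)"
      unfolding D_def case_prod_beta
      by (auto intro!: continuous_intros continuous_on_compose2[OF cd])
    have intD: "D x integrable_on cbox 0 1" for x
      unfolding D_def by (auto intro!: integrable_continuous_interval continuous_intros continuous_on_compose2[OF cd])
    have L: "((\<lambda>x. integral (cbox 0 1) (\<lambda>t. t ^ m * F (a + t *\<^sub>R (x - a)))) has_derivative
        blinfun_apply (integral (cbox 0 1) (D x0))) (at x0 within UNIV)" for x0
      by (rule leibniz_rule[OF der _ cD])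
         (auto intro!: integrable_continuous_interval continuous_intros continuous_on_compose2[OF cF])
    have I: "blinfun_apply (integral (cbox 0 1) (D x)) v =
        (\<Sum>b\<in>Basis. integral (cbox 0 1) (\<lambda>t. t ^ Suc m * ?dF b (a + t *\<^sub>R (x - a))) * (v \<bullet> b))" for x v
    proof -
      have "blinfun_apply (integral (cbox 0 1) (D x)) v = integral (cbox 0 1) (\<lambda>t. blinfun_apply (D x t) v)"
        by (rule blinfun_apply_integral[OF intD])
      also have "\<dots> = integral (cbox 0 1) (\<lambda>t. \<Sum>b\<in>Basis. (t ^ Suc m * ?dF b (a + t *\<^sub>R (x - a))) * (v \<bullet> b))"
        by (simp add: D_def blinfun.sum_left blinfun.scaleR_left)
      also have "\<dots> = (\<Sum>b\<in>Basis. integral (cbox 0 1) (\<lambda>t. (t ^ Suc m * ?dF b (a + t *\<^sub>R (x - a))) * (v \<bullet> b)))"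
        by (rule integral_sum)
           (auto intro!: integrable_continuous_interval continuous_intros continuous_on_compose2[OF cd])
      finally show ?thesis by simp
    qed
    show ?case
    proof (rule ck_on_SucI[OF open_UNIV L])
      fix v
      show "ck_on k UNIV (\<lambda>x. blinfun_apply (integral (cbox 0 1) (D x)) v)"
        unfolding I by (intro ck_on_sum ck_on_mult ck_on_const Suc.IH sd open_UNIV)
    qed
  qed
  then show ?thesis using assms by (simp add: smooth_on_def)
qed

text \<open>The factor of $(x-a)_b$ is the mean of the partial derivative along the segment from \<open>a\<close>
  to \<open>x\<close>.\<close>

lemma hadamard:
  fixes F :: "'e::euclidean_space \<Rightarrow> real"
  assumes "smooth_on UNIV F"
  obtains G where "\<And>b. smooth_on UNIV (G b)"
    "\<And>x. F x = F a + (\<Sum>b\<in>Basis. ((x - a) \<bullet> b) * G b x)"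
    "\<And>b. G b a = frechet_derivative F (at a) b"
proof
  let ?dF = "\<lambda>b y. frechet_derivative F (at y) b"
  let ?G = "\<lambda>b x. integral {0..1} (\<lambda>t. t ^ 0 * ?dF b (a + t *\<^sub>R (x - a)))"
  have sd: "smooth_on UNIV (?dF b)" for b by (rule smooth_on_frechet_derivative[OF assms])
  have cd: "continuous_on UNIV (?dF b)" for b by (rule smooth_on_continuous_on[OF sd])
  show "smooth_on UNIV (?G b)" for b by (rule smooth_segment_mean[OF sd])
  show "?G b a = ?dF b a" for b by simp
  fix x
  have "((\<lambda>t. F (a + t *\<^sub>R (x - a))) has_vector_derivative (\<Sum>b\<in>Basis. ((x - a) \<bullet> b) * ?dF b (a + t *\<^sub>R (x - a))))
      (at t within {0..1})" for t
  proof -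
    let ?y = "a + t *\<^sub>R (x - a)"
    interpret linear "frechet_derivative F (at ?y)"
      using smooth_on_has_derivative[OF assms] has_derivative_linear by blast
    have e: "frechet_derivative F (at ?y) (x - a) = (\<Sum>b\<in>Basis. ((x - a) \<bullet> b) * ?dF b ?y)"
      by (subst (2) euclidean_representation[of "x - a", symmetric]) (simp add: sum scale)
    have "((\<lambda>t. F (a + t *\<^sub>R (x - a))) has_derivative (\<lambda>s. frechet_derivative F (at ?y) (s *\<^sub>R (x - a)))) (at t within {0..1})"
      by (rule has_derivative_compose[OF _ smooth_on_has_derivative[OF assms UNIV_I]])
         (auto intro!: derivative_eq_intros)
    then show ?thesis by (simp add: has_vector_derivative_def scale e)
  qed
  then have "((\<lambda>t. \<Sum>b\<in>Basis. ((x - a) \<bullet> b) * ?dF b (a + t *\<^sub>R (x - a))) has_integral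
      F (a + 1 *\<^sub>R (x - a)) - F (a + 0 *\<^sub>R (x - a))) {0..1}"
    by (intro fundamental_theorem_of_calculus) auto
  then have "F x - F a = integral {0..1} (\<lambda>t. \<Sum>b\<in>Basis. ((x - a) \<bullet> b) * ?dF b (a + t *\<^sub>R (x - a)))"
    by (simp add: integral_unique)
  also have "\<dots> = (\<Sum>b\<in>Basis. integral {0..1} (\<lambda>t. ((x - a) \<bullet> b) * ?dF b (a + t *\<^sub>R (x - a))))"
    by (rule integral_sum)
       (auto intro!: integrable_continuous_interval continuous_intros continuous_on_compose2[OF cd])
  also have "\<dots> = (\<Sum>b\<in>Basis. ((x - a) \<bullet> b) * ?G b x)" by simp
  finally show "F x = F a + (\<Sum>b\<in>Basis. ((x - a) \<bullet> b) * ?G b x)" by simp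
qed


section \<open>Smooth functions and tangent vectors on a manifold\<close>

lemma sum_fun_apply: "(\<Sum>i\<in>I. f i) x = (\<Sum>i\<in>I. f i x)"
  by (induction I rule: infinite_finite_induct) auto

lemma chart_inverse: "q \<in> V \<Longrightarrow> homeomorphism V W \<psi> (inv_into V \<psi>) \<Longrightarrow> inv_into V \<psi> (\<psi> q) = q"
  by (simp add: homeomorphism_def)

lemma chart_open_image:
  assumes "homeomorphism V (\<psi> ` V) \<psi> g" "open (\<psi> ` V)" "open V" "open U" "U \<subseteq> V"
  shows "open (\<psi> ` U)"
proof -
  have "openin (top_of_set V) U" using assms by (simp add: openin_open_eq)
  from homeomorphism_imp_open_map[OF assms(1) this] show ?thesis
    using assms(2) openin_open_trans by blast
qed

lemma smooth_funs_iff: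
  "f \<in> smooth_funs A \<longleftrightarrow> (\<forall>(V, \<psi>)\<in>A. smooth_on (\<psi> ` V) (\<lambda>x. f (inv_into V \<psi> x)))"
  by (simp add: smooth_funs_def smooth_fun_on_def o_def)

lemma smooth_fun_on_subset: "smooth_fun_on A U f \<Longrightarrow> W \<subseteq> U \<Longrightarrow> smooth_fun_on A W f"
  unfolding smooth_fun_on_def by (fastforce intro: smooth_on_subset)

context
  fixes A :: "('a::{t2_space,second_countable_topology}, 'e::euclidean_space) atlas"
  assumes atlas: "smooth_atlas A"
begin

lemma atlas_chart:
  assumes "(V, \<psi>) \<in> A"
  shows "open V" "open (\<psi> ` V)" "homeomorphism V (\<psi> ` V) \<psi> (inv_into V \<psi>)"
  using atlas assms unfolding smooth_atlas_def by blast+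

lemma smooth_funs_const [simp]: "(\<lambda>_. c) \<in> smooth_funs A"
  by (auto simp: smooth_funs_iff o_def smooth_on_const)

lemma smooth_funs_zero [simp]: "0 \<in> smooth_funs A"
  unfolding zero_fun_def by (rule smooth_funs_const)

lemma smooth_funs_add [simp]:
  assumes "f \<in> smooth_funs A" "g \<in> smooth_funs A"
  shows "f + g \<in> smooth_funs A"
proof -
  have "smooth_on (\<psi> ` V) (\<lambda>x. f (inv_into V \<psi> x) + g (inv_into V \<psi> x))" if "(V, \<psi>) \<in> A" for V \<psi>
    by (rule smooth_on_add) (use assms that atlas_chart in \<open>auto simp: smooth_funs_iff\<close>)
  then show ?thesis by (auto simp: smooth_funs_iff o_def)
qed

lemma smooth_funs_mult [simp]:
  assumes "f \<in> smooth_funs A" "g \<in> smooth_funs A"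
  shows "f * g \<in> smooth_funs A"
proof -
  have "smooth_on (\<psi> ` V) (\<lambda>x. f (inv_into V \<psi> x) * g (inv_into V \<psi> x))" if "(V, \<psi>) \<in> A" for V \<psi>
    by (rule smooth_on_mult) (use assms that atlas_chart in \<open>auto simp: smooth_funs_iff\<close>)
  then show ?thesis by (auto simp: smooth_funs_iff o_def)
qed

lemma smooth_funs_scaleR [simp]:
  assumes "f \<in> smooth_funs A"
  shows "c *\<^sub>R f \<in> smooth_funs A"
proof -
  have "(\<lambda>_. c) * f \<in> smooth_funs A" using assms by (intro smooth_funs_mult smooth_funs_const)
  then show ?thesis by (simp add: scaleR_fun_def times_fun_def)
qed

lemma smooth_funs_sum: "(\<And>i. i \<in> I \<Longrightarrow> f i \<in> smooth_funs A) \<Longrightarrow> (\<Sum>i\<in>I. f i) \<in> smooth_funs A"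
  by (induction I rule: infinite_finite_induct) auto

lemma smooth_funs_continuous:
  assumes "f \<in> smooth_funs A"
  shows "continuous_on UNIV f"
proof (rule continuous_at_imp_continuous_on, rule ballI)
  fix p
  obtain V \<psi> where V: "(V, \<psi>) \<in> A" "p \<in> V"
    using atlas unfolding smooth_atlas_def by blast
  note c = atlas_chart[OF V(1)]
  have "continuous_on (\<psi> ` V) (\<lambda>x. f (inv_into V \<psi> x))"
    using assms V(1) by (auto simp: smooth_funs_iff intro!: smooth_on_continuous_on)
  moreover have "continuous_on V \<psi>" using c(3) by (simp add: homeomorphism_def)
  ultimately have "continuous_on V (\<lambda>q. f (inv_into V \<psi> (\<psi> q)))"
    by (rule continuous_on_compose2) auto
  then have "continuous_on V f"
    by (rule continuous_on_eq) (simp add: chart_inverse[OF _ c(3)])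
  then show "isCont f p" using c(1) V(2) by (simp add: continuous_on_eq_continuous_at)
qed

lemma subspace_tangent_space: "subspace (tangent_space A p)"
  by (auto simp: subspace_def tangent_space_def algebra_simps)

lemma tangent_vector_const:
  assumes "v \<in> tangent_space A p"
  shows "v (\<lambda>_. c) = 0"
proof -
  have "v (1 * 1) = 1 * v 1 + 1 * v 1"
    using assms smooth_funs_const[of 1] by (auto simp: tangent_space_def one_fun_def)
  then have "v 1 = 0" by simp
  moreover have "v (c *\<^sub>R 1) = c * v 1"
    using assms smooth_funs_const[of 1] by (auto simp: tangent_space_def one_fun_def)
  moreover have "(\<lambda>_. c) = (c *\<^sub>R 1 :: 'a \<Rightarrow> real)" by (simp add: fun_eq_iff)
  ultimately show ?thesis by simp
qed

lemma tangent_vector_sum: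
  assumes "v \<in> tangent_space A p" "\<And>i. i \<in> I \<Longrightarrow> f i \<in> smooth_funs A"
  shows "v (\<Sum>i\<in>I. f i) = (\<Sum>i\<in>I. v (f i))"
  using assms(2)
proof (induction I rule: infinite_finite_induct)
  case (insert i I)
  then have "v (f i + sum f I) = v (f i) + v (sum f I)"
    using assms(1) smooth_funs_sum[of I f] unfolding tangent_space_def by blast
  then show ?case using insert by (simp only: sum.insert[OF insert.hyps]) simp
qed (use tangent_vector_const[OF assms(1), of 0] in \<open>auto simp: zero_fun_def\<close>)

lemma vector_fieldsI:
  assumes "\<And>p. X p \<in> tangent_space A p" "\<And>f. f \<in> smooth_funs A \<Longrightarrow> (\<lambda>p. X p f) \<in> smooth_funs A"
  shows "X \<in> vector_fields A"
  using assms by (auto simp: vector_fields_def vector_fields_on_def smooth_funs_def)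

lemma vector_fieldsD:
  assumes "X \<in> vector_fields A"
  shows "X p \<in> tangent_space A p" "f \<in> smooth_funs A \<Longrightarrow> (\<lambda>p. X p f) \<in> smooth_funs A"
  using assms by (auto simp: vector_fields_def vector_fields_on_def smooth_funs_def)

lemma vector_fields_restrict: "X \<in> vector_fields A \<Longrightarrow> X \<in> vector_fields_on A U"
  by (auto simp: vector_fields_def vector_fields_on_def intro: smooth_fun_on_subset)

lemma vector_fields_zero [simp]: "0 \<in> vector_fields A"
  using subspace_tangent_space by (auto intro!: vector_fieldsI simp: subspace_def)

lemma vector_fields_add [simp]:
  assumes "X \<in> vector_fields A" "Y \<in> vector_fields A"
  shows "X + Y \<in> vector_fields A"
proof (rule vector_fieldsI)
  show "(X + Y) p \<in> tangent_space A p" for p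
    using assms vector_fieldsD(1) subspace_add[OF subspace_tangent_space] by simp
  fix f assume f: "f \<in> smooth_funs A"
  have "(\<lambda>p. X p f) + (\<lambda>p. Y p f) \<in> smooth_funs A"
    by (rule smooth_funs_add[OF vector_fieldsD(2)[OF assms(1) f] vector_fieldsD(2)[OF assms(2) f]])
  then show "(\<lambda>p. (X + Y) p f) \<in> smooth_funs A" by (simp add: plus_fun_def)
qed

lemma vector_fields_fsmul [simp]:
  assumes "f \<in> smooth_funs A" "X \<in> vector_fields A"
  shows "f \<odot> X \<in> vector_fields A"
proof (rule vector_fieldsI)
  show "(f \<odot> X) p \<in> tangent_space A p" for p
    using assms vector_fieldsD(1) subspace_scale[OF subspace_tangent_space] by (simp add: fsmul_def)
  fix k assume k: "k \<in> smooth_funs A"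
  have "f * (\<lambda>p. X p k) \<in> smooth_funs A"
    by (rule smooth_funs_mult[OF assms(1) vector_fieldsD(2)[OF assms(2) k]])
  then show "(\<lambda>p. (f \<odot> X) p k) \<in> smooth_funs A" by (simp add: fsmul_def times_fun_def)
qed

lemma vector_fields_scaleR [simp]: "X \<in> vector_fields A \<Longrightarrow> c *\<^sub>R X \<in> vector_fields A"
  using vector_fields_fsmul[of "\<lambda>_. c" X] by (simp add: fsmul_def scaleR_fun_def[abs_def])

lemma vector_fields_uminus [simp]: "X \<in> vector_fields A \<Longrightarrow> - X \<in> vector_fields A"
  using vector_fields_scaleR[of X "-1"] by simp

lemma vector_fields_diff [simp]:
  "X \<in> vector_fields A \<Longrightarrow> Y \<in> vector_fields A \<Longrightarrow> X - Y \<in> vector_fields A"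
  using vector_fields_add[of X "- Y"] by simp

lemma vector_fields_sum:
  "(\<And>i. i \<in> I \<Longrightarrow> X i \<in> vector_fields A) \<Longrightarrow> (\<Sum>i\<in>I. X i) \<in> vector_fields A"
  by (induction I rule: infinite_finite_induct) auto

end

text \<open>Extension by zero of a function given in a chart. A support in a closed ball inside the chart
  domain makes the complement of the support an open set, on which the extension is zero.\<close>

definition chart_extend :: "'a set \<Rightarrow> ('a \<Rightarrow> 'e) \<Rightarrow> ('e \<Rightarrow> real) \<Rightarrow> 'a \<Rightarrow> real" where
  "chart_extend V \<psi> F q = (if q \<in> V then F (\<psi> q) else 0)"

lemma chart_extend_smooth:
  fixes A :: "('a::{t2_space,second_countable_topology}, 'e::euclidean_space) atlas"
  assumes A: "smooth_atlas A" and V: "(V, \<psi>) \<in> A" and F: "smooth_on (\<psi> ` V) F"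
    and ball: "cball a r \<subseteq> \<psi> ` V" and supp: "\<And>x. x \<notin> cball a r \<Longrightarrow> F x = 0"
  shows "chart_extend V \<psi> F \<in> smooth_funs A"
  unfolding smooth_funs_iff
proof clarify
  fix W \<theta> assume W: "(W, \<theta>) \<in> A"
  note v = atlas_chart[OF A V] and w = atlas_chart[OF A W]
  define K where "K = inv_into V \<psi> ` cball a r"
  have "continuous_on (cball a r) (inv_into V \<psi>)"
    using v(3) ball by (auto simp: homeomorphism_def intro: continuous_on_subset)
  then have "closed K"
    unfolding K_def by (intro compact_imp_closed compact_continuous_image) auto
  let ?f = "\<lambda>y. chart_extend V \<psi> F (inv_into W \<theta> y)"
  have o1: "open (\<theta> ` (W \<inter> V))" by (rule chart_open_image[OF w(3) w(2) w(1)]) (use v w in auto)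
  have o2: "open (\<theta> ` (W - K))"
    by (rule chart_open_image[OF w(3) w(2) w(1)]) (use w \<open>closed K\<close> in auto)
  have "smooth_on (\<theta> ` (W \<inter> V)) (\<lambda>y. F ((\<psi> \<circ> inv_into W \<theta>) y))"
  proof (rule smooth_on_compose[OF o1 v(2) _ _ F])
    show "(\<psi> \<circ> inv_into W \<theta>) ` \<theta> ` (W \<inter> V) \<subseteq> \<psi> ` V" using chart_inverse[OF _ w(3)] by auto
    show "smooth_on (\<theta> ` (W \<inter> V)) (\<psi> \<circ> inv_into W \<theta>)" using A V W unfolding smooth_atlas_def by blast
  qed
  then have "smooth_on (\<theta> ` (W \<inter> V)) ?f"
    by (rule smooth_on_cong[OF o1, rotated]) (auto simp: chart_extend_def chart_inverse[OF _ w(3)])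
  moreover have "smooth_on (\<theta> ` (W - K)) ?f"
  proof (rule smooth_on_cong[OF o2 _ smooth_on_const])
    fix y assume "y \<in> \<theta> ` (W - K)"
    then obtain q where q: "q \<in> W" "q \<notin> K" "y = \<theta> q" by auto
    have "\<psi> q \<notin> cball a r" if "q \<in> V"
      using q(2) chart_inverse[OF that v(3)] unfolding K_def by (metis image_eqI)
    then show "0 = ?f y" using q chart_inverse[OF _ w(3)] supp by (auto simp: chart_extend_def)
  qed
  moreover have "\<theta> ` W = \<theta> ` (W \<inter> V) \<union> \<theta> ` (W - K)"
  proof -
    have "K \<subseteq> V" unfolding K_def using ball inv_into_into[of _ \<psi> V] by auto
    then show ?thesis by auto
  qed
  ultimately show "smooth_on (\<theta> ` W) ?f" using smooth_on_Un[OF o1 o2] by simp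
qed

text \<open>With \<open>\<beta> = 1\<close> and vanishing derivative at the centre, a function and its product with \<open>\<beta>\<close> have the
  same value and the same partial derivatives there.\<close>

locale chart_with_bump =
  fixes A :: "('a::{t2_space,second_countable_topology}, 'e::euclidean_space) atlas"
    and V :: "'a set" and \<psi> :: "'a \<Rightarrow> 'e" and p :: 'a and r :: real and \<beta> :: "'e \<Rightarrow> real"
  assumes atlas: "smooth_atlas A" and chart: "(V, \<psi>) \<in> A" and pV: "p \<in> V"
    and ball: "cball (\<psi> p) r \<subseteq> \<psi> ` V"
    and bump_smooth: "smooth_on UNIV \<beta>" and bump_center: "\<beta> (\<psi> p) = 1"
    and bump_derivative: "(\<beta> has_derivative (\<lambda>_. 0)) (at (\<psi> p))"
    and bump_support: "\<And>x. x \<notin> cball (\<psi> p) r \<Longrightarrow> \<beta> x = 0"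
begin

abbreviation local_rep :: "('a \<Rightarrow> real) \<Rightarrow> 'e \<Rightarrow> real" where
  "local_rep f \<equiv> \<lambda>x. f (inv_into V \<psi> x)"

definition cutoff :: "('e \<Rightarrow> real) \<Rightarrow> 'a \<Rightarrow> real" where
  "cutoff F = chart_extend V \<psi> (\<lambda>x. \<beta> x * F x)"

definition coord :: "'e \<Rightarrow> 'a \<Rightarrow> real" where
  "coord b = cutoff (\<lambda>x. (x - \<psi> p) \<bullet> b)"

definition partial :: "'a \<Rightarrow> 'e \<Rightarrow> 'a tvec" where
  "partial q b f = (if f \<in> smooth_funs A then frechet_derivative (local_rep f) (at (\<psi> q)) b else 0)"

definition frame :: "'e \<Rightarrow> 'a vfield" where
  "frame b q = (if q \<in> V then \<beta> (\<psi> q) *\<^sub>R partial q b else 0)"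

lemmas chart_facts = atlas_chart[OF atlas chart]

lemma inverse [simp]: "q \<in> V \<Longrightarrow> inv_into V \<psi> (\<psi> q) = q"
  using chart_inverse chart_facts(3) by blast

lemma cutoff_smooth:
  assumes "smooth_on (\<psi> ` V) F"
  shows "cutoff F \<in> smooth_funs A"
  unfolding cutoff_def
  by (rule chart_extend_smooth[OF atlas chart _ ball])
     (use assms bump_support bump_smooth chart_facts in
       \<open>auto intro!: smooth_on_mult intro: smooth_on_subset\<close>)

lemma coord_smooth: "coord b \<in> smooth_funs A"
  unfolding coord_def
proof (rule cutoff_smooth)
  have "smooth_on (\<psi> ` V) (\<lambda>x. x \<bullet> b + - (\<psi> p \<bullet> b))"
    by (intro smooth_on_add smooth_on_const smooth_on_bounded_linear bounded_linear_inner_left chart_facts)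
  then show "smooth_on (\<psi> ` V) (\<lambda>x. (x - \<psi> p) \<bullet> b)" by (simp add: inner_diff_left)
qed

lemma local_rep_smooth: "f \<in> smooth_funs A \<Longrightarrow> smooth_on (\<psi> ` V) (local_rep f)"
  using chart by (auto simp: smooth_funs_iff)

lemma local_rep_derivative:
  "f \<in> smooth_funs A \<Longrightarrow> q \<in> V \<Longrightarrow> (local_rep f has_derivative (\<lambda>b. partial q b f)) (at (\<psi> q))"
  using smooth_on_has_derivative[OF local_rep_smooth, of f "\<psi> q"] by (simp add: partial_def)

lemma partial_eqI:
  assumes "f \<in> smooth_funs A" "q \<in> V" "(local_rep f has_derivative D) (at (\<psi> q))"
  shows "partial q b f = D b"
  using has_derivative_unique[OF local_rep_derivative[OF assms(1,2)] assms(3)] by (rule fun_cong)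

lemma partial_tangent:
  assumes q: "q \<in> V"
  shows "partial q b \<in> tangent_space A q"
  unfolding tangent_space_def mem_Collect_eq
proof (intro conjI ballI allI impI)
  show "partial q b f = 0" if "f \<notin> smooth_funs A" for f using that by (simp add: partial_def)
  fix f assume f: "f \<in> smooth_funs A"
  note df = local_rep_derivative[OF f q]
  show "partial q b (c *\<^sub>R f) = c * partial q b f" for c
    by (rule partial_eqI[OF smooth_funs_scaleR[OF atlas f] q]) (use has_derivative_mult_right[OF df, of c] in simp)
  fix g assume g: "g \<in> smooth_funs A"
  note dg = local_rep_derivative[OF g q]
  show "partial q b (f + g) = partial q b f + partial q b g"
    by (rule partial_eqI[OF smooth_funs_add[OF atlas f g] q]) (use has_derivative_add[OF df dg] in simp)
  have "partial q b (f * g) = local_rep f (\<psi> q) * partial q b g + partial q b f * local_rep g (\<psi> q)"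
    by (rule partial_eqI[OF smooth_funs_mult[OF atlas f g] q]) (use has_derivative_mult[OF df dg] in simp)
  then show "partial q b (f * g) = f q * partial q b g + g q * partial q b f" using q by simp
qed

lemma partial_coord: "partial p b (coord c) = b \<bullet> c"
proof (rule partial_eqI[OF coord_smooth pV])
  have "((\<lambda>x. \<beta> x * ((x - \<psi> p) \<bullet> c)) has_derivative (\<lambda>b. b \<bullet> c)) (at (\<psi> p))"
    by (rule has_derivative_eq_rhs, rule derivative_intros bump_derivative)+
       (auto simp: bump_center intro!: derivative_eq_intros)
  then show "(local_rep (coord c) has_derivative (\<lambda>b. b \<bullet> c)) (at (\<psi> p))"
    by (rule has_derivative_transform_within_open[OF _ chart_facts(2)])
       (use pV in \<open>auto simp: coord_def cutoff_def chart_extend_def\<close>)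
qed

text \<open>By Hadamard's lemma, $\beta f = f(p) + \sum_b x_b G_b$ in the chart centred at \<open>p\<close>. Multiplying
  by $\beta^2$ makes every term a global smooth function, and the product rule for \<open>v\<close> gives
  $v f + f(p)\, v\beta = \sum_b v(x_b)\,\partial_b f(p)$; the case $f = 1$ gives $v\beta = 0$.\<close>

lemma tangent_vector_expansion:
  assumes v: "v \<in> tangent_space A p" and f: "f \<in> smooth_funs A"
  shows "v f = (\<Sum>b\<in>Basis. v (coord b) * partial p b f)"
proof -
  have leib: "v (h * k) = h p * v k + k p * v h" if "h \<in> smooth_funs A" "k \<in> smooth_funs A" for h k
    using v that by (auto simp: tangent_space_def)
  have lin: "v (h + k) = v h + v k" "v (c *\<^sub>R h) = c * v h"
    if "h \<in> smooth_funs A" "k \<in> smooth_funs A" for h k c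
    using v that by (auto simp: tangent_space_def)
  define B where "B = cutoff (\<lambda>_. 1)"
  have B: "B \<in> smooth_funs A" unfolding B_def by (rule cutoff_smooth[OF smooth_on_const])
  have Bp: "B p = 1" using pV by (simp add: B_def cutoff_def chart_extend_def bump_center)
  have expand: "v f + f p * v B = (\<Sum>b\<in>Basis. v (coord b) * partial p b f)"
    if f: "f \<in> smooth_funs A" for f
  proof -
    let ?F = "\<lambda>x. \<beta> x * local_rep f x"
    have o: "open (- cball (\<psi> p) r)" by auto
    have "smooth_on (\<psi> ` V) ?F"
      by (intro smooth_on_mult chart_facts local_rep_smooth f smooth_on_subset[OF bump_smooth]) auto
    moreover have "smooth_on (- cball (\<psi> p) r) ?F"
      by (rule smooth_on_cong[OF o _ smooth_on_const[of _ 0]]) (use bump_support in auto)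
    moreover have "\<psi> ` V \<union> - cball (\<psi> p) r = UNIV" using ball by auto
    ultimately have F: "smooth_on UNIV ?F" using smooth_on_Un[OF chart_facts(2) o] by metis
    obtain G where G: "\<And>b. smooth_on UNIV (G b)"
      "\<And>x. ?F x = ?F (\<psi> p) + (\<Sum>b\<in>Basis. ((x - \<psi> p) \<bullet> b) * G b x)"
      "\<And>b. G b (\<psi> p) = frechet_derivative ?F (at (\<psi> p)) b"
      using hadamard[OF F] by blast
    have cG: "cutoff (G b) \<in> smooth_funs A" for b
      by (rule cutoff_smooth[OF smooth_on_subset[OF G(1)]]) auto
    have Gp: "cutoff (G b) p = partial p b f" for b
    proof -
      have "(?F has_derivative (\<lambda>b. partial p b f)) (at (\<psi> p))"
        using has_derivative_mult[OF bump_derivative local_rep_derivative[OF f pV]] pV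
        by (simp add: bump_center)
      then show ?thesis
        using G(3)[of b] frechet_derivative_at[of ?F] pV bump_center
        by (simp add: cutoff_def chart_extend_def)
    qed
    have coord_p: "coord b p = 0" for b
      by (simp add: coord_def cutoff_def chart_extend_def)
    have "B * (B * (B * f)) = f p *\<^sub>R (B * B) + (\<Sum>b\<in>Basis. coord b * cutoff (G b))"
    proof
      fix q
      show "(B * (B * (B * f))) q = (f p *\<^sub>R (B * B) + (\<Sum>b\<in>Basis. coord b * cutoff (G b))) q"
      proof (cases "q \<in> V")
        case True
        have "\<beta> (\<psi> q) * f q = f p + (\<Sum>b\<in>Basis. ((\<psi> q - \<psi> p) \<bullet> b) * G b (\<psi> q))"
          using G(2)[of "\<psi> q"] True pV by (simp add: bump_center)
        then have "\<beta> (\<psi> q) * (\<beta> (\<psi> q) * (\<beta> (\<psi> q) * f q)) =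
            \<beta> (\<psi> q) * (\<beta> (\<psi> q) * (f p + (\<Sum>b\<in>Basis. ((\<psi> q - \<psi> p) \<bullet> b) * G b (\<psi> q))))" by simp
        then show ?thesis using True
          by (simp add: B_def coord_def cutoff_def chart_extend_def sum_fun_apply sum_distrib_left
              distrib_left mult_ac)
      next
        case False
        then show ?thesis by (simp add: B_def coord_def cutoff_def chart_extend_def sum_fun_apply)
      qed
    qed
    then have "v (B * (B * (B * f))) = v (f p *\<^sub>R (B * B) + (\<Sum>b\<in>Basis. coord b * cutoff (G b)))"
      by simp
    also have "\<dots> = f p * (2 * v B) + (\<Sum>b\<in>Basis. v (coord b * cutoff (G b)))"
      using B coord_smooth cG
      by (simp add: lin leib Bp atlas smooth_funs_sum[OF atlas] tangent_vector_sum[OF atlas v])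
    also have "(\<Sum>b\<in>Basis. v (coord b * cutoff (G b))) = (\<Sum>b\<in>Basis. v (coord b) * partial p b f)"
      by (rule sum.cong) (simp_all add: leib coord_smooth cG coord_p Gp)
    finally have "v (B * (B * (B * f))) = f p * (2 * v B) + (\<Sum>b\<in>Basis. v (coord b) * partial p b f)" .
    moreover have "v (B * (B * (B * f))) = v f + 3 * (f p * v B)"
      by (simp only: leib B f smooth_funs_mult[OF atlas] times_fun_apply Bp) simp
    ultimately show ?thesis by simp
  qed
  have one: "(\<lambda>_. 1) \<in> smooth_funs A" by (rule smooth_funs_const[OF atlas])
  have "partial p b (\<lambda>_. 1) = 0" for b by (rule partial_eqI[OF one pV]) (simp add: o_def)
  then have "v B = 0"
    using expand[OF one] tangent_vector_const[OF atlas v] by simp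
  then show ?thesis using expand[OF f] by simp
qed

lemma frame_vector_field: "frame b \<in> vector_fields A"
proof (rule vector_fieldsI[OF atlas])
  show "frame b q \<in> tangent_space A q" for q
    using subspace_tangent_space[OF atlas] partial_tangent
    by (auto simp: frame_def intro!: subspace_scale subspace_0)
  fix f assume f: "f \<in> smooth_funs A"
  have "(\<lambda>q. frame b q f) = cutoff (\<lambda>x. frechet_derivative (local_rep f) (at x) b)"
    using f by (auto simp: frame_def partial_def cutoff_def chart_extend_def fun_eq_iff)
  then show "(\<lambda>q. frame b q f) \<in> smooth_funs A"
    by (simp add: cutoff_smooth smooth_on_frechet_derivative local_rep_smooth f)
qed

lemma tangent_vector_eq:
  assumes "v \<in> tangent_space A p"
  shows "v = (\<Sum>b\<in>Basis. v (coord b) *\<^sub>R partial p b)"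
proof
  fix f
  show "v f = (\<Sum>b\<in>Basis. v (coord b) *\<^sub>R partial p b) f"
  proof (cases "f \<in> smooth_funs A")
    case True
    then show ?thesis by (simp add: sum_fun_apply tangent_vector_expansion[OF assms])
  next
    case False
    then show ?thesis using assms by (simp add: sum_fun_apply tangent_space_def partial_def)
  qed
qed

end

lemma chart_with_bump_exists:
  fixes A :: "('a::{t2_space,second_countable_topology}, 'e::euclidean_space) atlas"
  assumes "smooth_atlas A"
  obtains V \<psi> r \<beta> where "chart_with_bump A V \<psi> p r \<beta>"
proof -
  obtain V \<psi> where V: "(V, \<psi>) \<in> A" "p \<in> V"
    using assms unfolding smooth_atlas_def by blast
  obtain r where r: "0 < r" "cball (\<psi> p) r \<subseteq> \<psi> ` V"
    using atlas_chart(2)[OF assms V(1)] V(2) open_contains_cball by (metis image_eqI)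
  obtain \<beta> :: "'e \<Rightarrow> real" where "smooth_on UNIV \<beta>" "\<beta> (\<psi> p) = 1" "(\<beta> has_derivative (\<lambda>_. 0)) (at (\<psi> p))"
    "\<And>x. x \<notin> cball (\<psi> p) r \<Longrightarrow> \<beta> x = 0"
    using bump_exists[OF r(1)] by metis
  then have "chart_with_bump A V \<psi> p r \<beta>"
    using assms V r by unfold_locales auto
  then show thesis by (rule that)
qed

lemma tangent_vector_extension:
  fixes A :: "('a::{t2_space,second_countable_topology}, 'e::euclidean_space) atlas"
  assumes "smooth_atlas A" "v \<in> tangent_space A p"
  obtains X where "X \<in> vector_fields A" "X p = v"
proof -
  obtain V \<psi> r \<beta> where "chart_with_bump A V \<psi> p r \<beta>"
    using chart_with_bump_exists[OF assms(1)] by metis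
  then interpret chart_with_bump A V \<psi> p r \<beta> .
  let ?X = "\<Sum>b\<in>Basis. v (coord b) *\<^sub>R frame b"
  have "?X \<in> vector_fields A"
    by (intro vector_fields_sum vector_fields_scaleR frame_vector_field assms(1))
  moreover have "?X p = v"
    using tangent_vector_eq[OF assms(2)] pV by (simp add: sum_fun_apply frame_def bump_center)
  ultimately show thesis by (rule that)
qed

lemma linear_evaluation: "linear (\<lambda>v :: 'a tvec. \<Sum>b\<in>(Basis :: 'e::euclidean_space set). v (x b) *\<^sub>R b)"
  by (rule linearI) (simp_all add: scaleR_add_left sum.distrib scaleR_sum_right)

text \<open>Evaluation on finitely many smooth functions identifies the tangent space with the model
  space. The functions being global, the same evaluation applies to the values of a vector field at all
  points, and it depends continuously on the point.\<close>

lemma tangent_space_coordinates: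
  fixes A :: "('a::{t2_space,second_countable_topology}, 'e::euclidean_space) atlas"
  assumes "smooth_atlas A"
  obtains x :: "'e \<Rightarrow> 'a \<Rightarrow> real" where "\<And>b. x b \<in> smooth_funs A"
    "inj_on (\<lambda>v. \<Sum>b\<in>Basis. v (x b) *\<^sub>R b) (tangent_space A p)"
    "(\<lambda>v. \<Sum>b\<in>Basis. v (x b) *\<^sub>R b) ` tangent_space A p = UNIV"
proof -
  obtain V \<psi> r \<beta> where "chart_with_bump A V \<psi> p r \<beta>"
    using chart_with_bump_exists[OF assms(1)] by metis
  then interpret chart_with_bump A V \<psi> p r \<beta> .
  let ?L = "\<lambda>v. \<Sum>b\<in>Basis. v (coord b) *\<^sub>R b"
  show thesis
  proof (rule that[OF coord_smooth])
    show "inj_on ?L (tangent_space A p)"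
    proof (rule inj_onI)
      fix v w assume vw: "v \<in> tangent_space A p" "w \<in> tangent_space A p" "?L v = ?L w"
      have "v (coord b) = w (coord b)" if "b \<in> Basis" for b
        using arg_cong[OF vw(3), of "\<lambda>u. u \<bullet> b"] that by (simp add: inner_sum_left_Basis)
      then show "v = w"
        by (subst tangent_vector_eq[OF vw(1)], subst tangent_vector_eq[OF vw(2)]) simp
    qed
    have "c \<in> ?L ` tangent_space A p" for c
    proof (rule image_eqI)
      let ?v = "\<Sum>b\<in>Basis. (c \<bullet> b) *\<^sub>R partial p b"
      show "?v \<in> tangent_space A p"
        by (intro subspace_sum subspace_scale subspace_tangent_space assms partial_tangent pV)
      have "?v (coord b) = c \<bullet> b" if "b \<in> Basis" for b
        using that by (simp add: sum_fun_apply partial_coord inner_Basis if_distrib sum.delta cong: if_cong)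
      then show "c = ?L ?v" by (simp add: euclidean_representation)
    qed
    then show "?L ` tangent_space A p = UNIV" by auto
  qed
qed


section \<open>Calculus of vector fields on a contact metric manifold\<close>

lemma linear_map_onD:
  assumes "linear_map_on V L" "v \<in> V" "w \<in> V"
  shows "L (v + w) = L v + L w" "L (c *\<^sub>R v) = c *\<^sub>R L v"
  using assms by (auto simp: linear_map_on_def)

locale contact_metric =
  fixes A :: "('a::{t2_space,second_countable_topology}, 'e::euclidean_space) atlas"
    and n :: nat and \<phi> :: "'a endo_field" and \<xi> :: "'a vfield" and \<eta> :: "'a form1" and g :: "'a form2"
    and nabla :: "'a vfield \<Rightarrow> 'a vfield \<Rightarrow> 'a vfield"
  assumes contact: "contact_metric_manifold A n \<phi> \<xi> \<eta> g"
    and levi_civita: "levi_civita A g nabla"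
begin

abbreviation VF :: "'a vfield set" where "VF \<equiv> vector_fields A"
abbreviation Tan :: "'a \<Rightarrow> 'a tvec set" where "Tan \<equiv> tangent_space A"
abbreviation ip :: "'a vfield \<Rightarrow> 'a vfield \<Rightarrow> 'a \<Rightarrow> real" where "ip \<equiv> app2 g"
abbreviation phi :: "'a vfield \<Rightarrow> 'a vfield" where "phi \<equiv> app \<phi>"
abbreviation K :: "'a vfield \<Rightarrow> 'a vfield \<Rightarrow> 'a vfield \<Rightarrow> 'a \<Rightarrow> real" where
  "K X Y Z \<equiv> ip (nabla X Y) Z"

text \<open>The contact metric condition forces the antisymmetric part of $-\nabla\xi$ to be $\phi$; this
  is the symmetric part. It turns out to be $\phi h$.\<close>

definition P :: "'a vfield \<Rightarrow> 'a vfield" where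
  "P X = - nabla X \<xi> - phi X"

text \<open>The covariant derivative of $\phi$, as the trilinear form $g((\nabla_X\phi)Y, Z)$.\<close>

definition T :: "'a vfield \<Rightarrow> 'a vfield \<Rightarrow> 'a vfield \<Rightarrow> 'a \<Rightarrow> real" where
  "T X Y Z p = K X (phi Y) Z p + K X Y (phi Z) p"

lemma atlas: "smooth_atlas A"
  and phi_endo: "smooth_endo_field A \<phi>" and xi_VF [simp]: "\<xi> \<in> VF" and eta_form: "smooth_one_form A \<eta>"
  and metric: "riemannian_metric A g"
  and phi_phi_at: "v \<in> Tan p \<Longrightarrow> \<phi> p (\<phi> p v) = - v + \<eta> p v *\<^sub>R \<xi> p"
  and eta_xi_at: "\<eta> p (\<xi> p) = 1"
  and compat_at: "v \<in> Tan p \<Longrightarrow> w \<in> Tan p \<Longrightarrow> g p (\<phi> p v) (\<phi> p w) = g p v w - \<eta> p v * \<eta> p w"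
  and d_eta: "X \<in> VF \<Longrightarrow> Y \<in> VF \<Longrightarrow> ext_deriv \<eta> X Y = ip X (phi Y)"
  using contact unfolding contact_metric_manifold_def by blast+

lemmas smooth_simps [simp] =
  vector_fields_zero[OF atlas] vector_fields_add[OF atlas] vector_fields_fsmul[OF atlas]
  vector_fields_scaleR[OF atlas] vector_fields_uminus[OF atlas] vector_fields_diff[OF atlas]

lemma VF_Tan [simp]: "X \<in> VF \<Longrightarrow> X p \<in> Tan p"
  by (rule vector_fieldsD[OF atlas])

lemma extension: "v \<in> Tan p \<Longrightarrow> \<exists>X\<in>VF. X p = v"
  using tangent_vector_extension[OF atlas] by metis

lemmas Tan_subspace = subspace_tangent_space[OF atlas]

lemma tangent_coordinates:
  obtains L :: "'a tvec \<Rightarrow> 'e" where "linear L" "inj_on L (Tan p)" "L ` Tan p = UNIV" "DIM('e) = 2 * n + 1"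
proof -
  have "DIM('e) = 2 * n + 1" using contact unfolding contact_metric_manifold_def by blast
  moreover obtain x :: "'e \<Rightarrow> 'a \<Rightarrow> real" where "\<And>b. x b \<in> smooth_funs A"
    "inj_on (\<lambda>v. \<Sum>b\<in>Basis. v (x b) *\<^sub>R b) (Tan p)"
    "(\<lambda>v. \<Sum>b\<in>Basis. v (x b) *\<^sub>R b) ` Tan p = UNIV"
    by (rule tangent_space_coordinates[OF atlas, of p], rule that)
  ultimately show thesis using that[OF linear_evaluation] by blast
qed

lemma phi_VF [simp]: "X \<in> VF \<Longrightarrow> phi X \<in> VF"
  using phi_endo by (auto simp: smooth_endo_field_def)

lemma phi_at [simp]: "v \<in> Tan p \<Longrightarrow> \<phi> p v \<in> Tan p"
  using phi_endo by (auto simp: smooth_endo_field_def)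

lemma phi_linear: "linear_map_on (Tan p) (\<phi> p)"
  using phi_endo by (auto simp: smooth_endo_field_def)

lemma eta_linear: "linear_map_on (Tan p) (\<eta> p)"
  using eta_form by (auto simp: smooth_one_form_def)

lemma phi_xi_at: "\<phi> p (\<xi> p) = 0"
proof -
  let ?c = "\<eta> p (\<phi> p (\<xi> p))"
  have x: "\<xi> p \<in> Tan p" by simp
  have phi0: "\<phi> p 0 = 0"
    using linear_map_onD(2)[OF phi_linear x x, of 0] by simp
  have "\<phi> p (\<phi> p (\<xi> p)) = 0" using phi_phi_at[OF x] by (simp add: eta_xi_at)
  then have e: "\<phi> p (\<xi> p) = ?c *\<^sub>R \<xi> p"
    using phi_phi_at[OF phi_at[OF x]] phi0 by (simp add: add_eq_0_iff)
  have "0 = \<phi> p (?c *\<^sub>R \<xi> p)" using \<open>\<phi> p (\<phi> p (\<xi> p)) = 0\<close> e by simp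
  also have "\<dots> = ?c *\<^sub>R ?c *\<^sub>R \<xi> p"
    using linear_map_onD(2)[OF phi_linear x x, of ?c] e by simp
  finally have "?c = 0 \<or> \<xi> p = 0" by simp
  then show ?thesis
  proof
    assume "\<xi> p = 0"
    then show ?thesis using phi0 by simp
  qed (use e in simp)
qed

lemma eta_at: "v \<in> Tan p \<Longrightarrow> \<eta> p v = g p v (\<xi> p)"
proof -
  assume v: "v \<in> Tan p"
  have "linear_map_on (Tan p) (g p (\<phi> p v))" using metric phi_at[OF v] unfolding riemannian_metric_def by blast
  then have "g p (\<phi> p v) 0 = 0"
    using linear_map_onD(2)[of "Tan p" "g p (\<phi> p v)" "\<xi> p" "\<xi> p" 0] by simp
  then show ?thesis using compat_at[OF v, of "\<xi> p"] by (simp add: phi_xi_at eta_xi_at)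
qed

lemma eta_field: "X \<in> VF \<Longrightarrow> app \<eta> X = ip X \<xi>"
  by (simp add: app_def app2_def eta_at fun_eq_iff)

lemma phi_xi [simp]: "phi \<xi> = 0"
  by (simp add: app_def phi_xi_at fun_eq_iff)

lemma ip_smooth [simp]: "X \<in> VF \<Longrightarrow> Y \<in> VF \<Longrightarrow> ip X Y \<in> smooth_funs A"
  using metric by (simp add: riemannian_metric_def)

lemma ip_sym: "X \<in> VF \<Longrightarrow> Y \<in> VF \<Longrightarrow> ip X Y = ip Y X"
  using metric by (simp add: riemannian_metric_def app2_def fun_eq_iff)

lemma ip_linear: "X \<in> VF \<Longrightarrow> linear_map_on (Tan p) (g p (X p))"
  using metric by (simp add: riemannian_metric_def)

lemma ip_add_right [simp]: "X \<in> VF \<Longrightarrow> Y \<in> VF \<Longrightarrow> Z \<in> VF \<Longrightarrow> ip X (Y + Z) p = ip X Y p + ip X Z p"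
  using linear_map_onD(1)[OF ip_linear] by (simp add: app2_def)

lemma ip_fsmul_right [simp]: "X \<in> VF \<Longrightarrow> Y \<in> VF \<Longrightarrow> ip X (f \<odot> Y) p = f p * ip X Y p"
  using linear_map_onD(2)[OF ip_linear, of X "Y p" p "Y p"] by (simp add: app2_def fsmul_def)

lemma ip_scaleR_right [simp]: "X \<in> VF \<Longrightarrow> Y \<in> VF \<Longrightarrow> ip X (c *\<^sub>R Y) p = c * ip X Y p"
  using linear_map_onD(2)[OF ip_linear, of X "Y p" p "Y p"] by (simp add: app2_def)

lemma ip_zero_right [simp]: "X \<in> VF \<Longrightarrow> ip X 0 p = 0"
  using ip_scaleR_right[of X X 0 p] by simp

lemma ip_uminus_right [simp]: "X \<in> VF \<Longrightarrow> Y \<in> VF \<Longrightarrow> ip X (- Y) p = - ip X Y p"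
  using ip_scaleR_right[of X Y "-1" p] by simp

lemma ip_diff_right [simp]: "X \<in> VF \<Longrightarrow> Y \<in> VF \<Longrightarrow> Z \<in> VF \<Longrightarrow> ip X (Y - Z) p = ip X Y p - ip X Z p"
  using ip_add_right[of X Y "- Z" p] by simp

lemma ip_left [simp]:
  assumes "X \<in> VF" "Y \<in> VF" "Z \<in> VF"
  shows "ip (X + Y) Z p = ip X Z p + ip Y Z p" "ip (X - Y) Z p = ip X Z p - ip Y Z p"
    "ip (- X) Z p = - ip X Z p" "ip (c *\<^sub>R X) Z p = c * ip X Z p"
    "f \<in> smooth_funs A \<Longrightarrow> ip (f \<odot> X) Z p = f p * ip X Z p" "ip 0 Z p = 0"
  using assms by (simp_all add: ip_sym[of _ Z])

lemma metric_pos: "v \<in> Tan p \<Longrightarrow> v \<noteq> 0 \<Longrightarrow> 0 < g p v v"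
  using metric unfolding riemannian_metric_def by blast

lemma ip_zero_imp:
  assumes "X \<in> VF" "ip X X p = 0"
  shows "X p = 0"
  using metric_pos[OF VF_Tan[OF assms(1)], of p] assms(2) unfolding app2_def by linarith

lemma field_eqI:
  assumes "X \<in> VF" "Y \<in> VF" "\<And>Z. Z \<in> VF \<Longrightarrow> ip X Z p = ip Y Z p"
  shows "X p = Y p"
proof -
  have "ip (X - Y) (X - Y) p = 0" using assms(1,2) assms(3)[of "X - Y"] by (simp del: ip_diff_right)
  then have "(X - Y) p = 0" using assms(1,2) ip_zero_imp[of "X - Y" p] by simp
  then show ?thesis by simp
qed

lemma field_eqI_global:
  assumes "X \<in> VF" "Y \<in> VF" "\<And>Z p. Z \<in> VF \<Longrightarrow> ip X Z p = ip Y Z p"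
  shows "X = Y"
  using field_eqI[OF assms(1,2) assms(3)] by (simp add: fun_eq_iff[of X Y])

lemma ip_xi_xi [simp]: "ip \<xi> \<xi> = (\<lambda>_. 1)"
  using eta_field[of \<xi>] by (simp add: app_def eta_xi_at)

lemma zero_fsmul [simp]: "(\<lambda>_. 0) \<odot> X = 0"
  by (simp add: fsmul_def fun_eq_iff)

lemma phi_phi: "X \<in> VF \<Longrightarrow> phi (phi X) = ip X \<xi> \<odot> \<xi> - X"
  by (rule ext) (simp add: app_def app2_def fsmul_def phi_phi_at eta_at)

lemma compat: "X \<in> VF \<Longrightarrow> Y \<in> VF \<Longrightarrow> ip (phi X) (phi Y) p = ip X Y p - ip X \<xi> p * ip Y \<xi> p"
  by (simp add: app_def app2_def compat_at eta_at)

lemma eta_phi [simp]: 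
  assumes "X \<in> VF"
  shows "ip (phi X) \<xi> = (\<lambda>_. 0)"
proof
  fix p
  have "phi (phi (phi X)) p = (ip (phi X) \<xi> \<odot> \<xi> - phi X) p" using assms by (subst phi_phi) auto
  moreover have "phi (phi (phi X)) p = - phi X p"
  proof -
    have x: "X p \<in> Tan p" "\<xi> p \<in> Tan p" using assms by auto
    have m: "(-1) *\<^sub>R X p \<in> Tan p" "c *\<^sub>R \<xi> p \<in> Tan p" for c
      using subspace_scale[OF Tan_subspace] x by blast+
    have "\<phi> p (\<phi> p (\<phi> p (X p))) = \<phi> p ((-1) *\<^sub>R X p + \<eta> p (X p) *\<^sub>R \<xi> p)"
      by (simp add: phi_phi_at x)
    also have "\<dots> = - \<phi> p (X p)"
      unfolding linear_map_onD(1)[OF phi_linear m] linear_map_onD(2)[OF phi_linear x(1) x(1)]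
        linear_map_onD(2)[OF phi_linear x(2) x(2)] by (simp add: phi_xi_at)
    finally show ?thesis by (simp add: app_def)
  qed
  ultimately have "ip (phi X) \<xi> p *\<^sub>R \<xi> p = 0" by (simp add: fsmul_def)
  moreover have "\<xi> p \<noteq> 0"
  proof
    assume "\<xi> p = 0"
    then have "ip \<xi> \<xi> p = ip \<xi> 0 p" by (simp add: app2_def)
    then show False by simp
  qed
  ultimately show "ip (phi X) \<xi> p = 0" by simp
qed

lemma ip_phi:
  assumes "X \<in> VF" "Y \<in> VF"
  shows "ip (phi X) Y p = - ip X (phi Y) p"
proof -
  have "ip (phi (phi X)) (phi Y) p = ip (phi X) Y p" using assms by (simp add: compat)
  then show ?thesis using assms by (simp add: phi_phi ip_sym[of \<xi> "phi Y"])
qed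

lemma derivation_add:
  assumes "X \<in> VF" "f \<in> smooth_funs A" "k \<in> smooth_funs A"
  shows "X p (f + k) = X p f + X p k"
  using VF_Tan[OF assms(1), of p] assms(2,3) unfolding tangent_space_def by blast

lemma derivation_scaleR:
  assumes "X \<in> VF" "f \<in> smooth_funs A"
  shows "X p (c *\<^sub>R f) = c * X p f"
  using VF_Tan[OF assms(1), of p] assms(2) unfolding tangent_space_def by blast

lemma derivation_diff:
  assumes "X \<in> VF" "f \<in> smooth_funs A" "k \<in> smooth_funs A"
  shows "X p (f - k) = X p f - X p k"
proof -
  have "X p (f + (-1) *\<^sub>R k) = X p f + (-1) * X p k"
    using assms by (simp only: derivation_add smooth_funs_scaleR[OF atlas] derivation_scaleR)
  moreover have "f + (-1) *\<^sub>R k = f - k" by (simp add: fun_eq_iff)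
  ultimately show ?thesis by simp
qed

lemma derivation_const [simp]: "X \<in> VF \<Longrightarrow> X p (\<lambda>_. c) = 0"
  using tangent_vector_const[OF atlas VF_Tan] by blast

lemma deriv_along_smooth [simp]: "X \<in> VF \<Longrightarrow> f \<in> smooth_funs A \<Longrightarrow> deriv_along X f \<in> smooth_funs A"
  unfolding deriv_along_def by (rule vector_fieldsD(2)[OF atlas])

lemma nabla_VF [simp]: "X \<in> VF \<Longrightarrow> Y \<in> VF \<Longrightarrow> nabla X Y \<in> VF"
  and nabla_add_right: "X \<in> VF \<Longrightarrow> Y \<in> VF \<Longrightarrow> Z \<in> VF \<Longrightarrow> nabla X (Y + Z) = nabla X Y + nabla X Z"
  and nabla_leibniz: "X \<in> VF \<Longrightarrow> Y \<in> VF \<Longrightarrow> f \<in> smooth_funs A \<Longrightarrow>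
        nabla X (f \<odot> Y) = deriv_along X f \<odot> Y + f \<odot> nabla X Y"
  and torsion_free: "X \<in> VF \<Longrightarrow> Y \<in> VF \<Longrightarrow> nabla X Y - nabla Y X = lie_bracket X Y"
  and metric_connection: "X \<in> VF \<Longrightarrow> Y \<in> VF \<Longrightarrow> Z \<in> VF \<Longrightarrow>
        deriv_along X (ip Y Z) = ip (nabla X Y) Z + ip Y (nabla X Z)"
  using levi_civita smooth_funs_const[OF atlas, of 0] unfolding levi_civita_def by blast+

lemma bracket_VF [simp]: "X \<in> VF \<Longrightarrow> Y \<in> VF \<Longrightarrow> lie_bracket X Y \<in> VF"
  using torsion_free[of X Y] nabla_VF by (metis smooth_simps(6))

lemma nabla_diff_right:
  assumes "X \<in> VF" "Y \<in> VF" "Z \<in> VF"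
  shows "nabla X (Y - Z) = nabla X Y - nabla X Z"
  using nabla_add_right[of X "Y - Z" Z] assms by simp

lemma nabla_zero_right [simp]: "X \<in> VF \<Longrightarrow> nabla X 0 = 0"
  using nabla_diff_right[of X X X] by simp

lemma nabla_uminus_right:
  assumes "X \<in> VF" "Y \<in> VF"
  shows "nabla X (- Y) = - nabla X Y"
  using nabla_diff_right[of X 0 Y] assms by simp

lemma nabla_scaleR_right:
  assumes "X \<in> VF" "Y \<in> VF"
  shows "nabla X (c *\<^sub>R Y) = c *\<^sub>R nabla X Y"
proof -
  have e: "c *\<^sub>R Z = (\<lambda>_. c) \<odot> Z" for Z :: "'a vfield" by (simp add: fsmul_def fun_eq_iff)
  have "deriv_along X (\<lambda>_. c) = (\<lambda>_. 0)" using assms by (simp add: deriv_along_def)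
  then show ?thesis
    unfolding e using assms by (subst nabla_leibniz) (simp_all add: smooth_funs_const[OF atlas] fsmul_def fun_eq_iff)
qed

lemma metric_at: "X \<in> VF \<Longrightarrow> Y \<in> VF \<Longrightarrow> Z \<in> VF \<Longrightarrow> X p (ip Y Z) = K X Y Z p + K X Z Y p"
  using fun_cong[OF metric_connection, of X Y Z p] ip_sym[of Y "nabla X Z"] by (simp add: deriv_along_def)

lemma bracket_ip: "X \<in> VF \<Longrightarrow> Y \<in> VF \<Longrightarrow> Z \<in> VF \<Longrightarrow> ip (lie_bracket X Y) Z p = K X Y Z p - K Y X Z p"
  unfolding torsion_free[symmetric] by simp

lemma nabla_xi: "nabla X \<xi> = - P X - phi X"
  by (simp add: P_def)

lemma P_VF [simp]: "X \<in> VF \<Longrightarrow> P X \<in> VF"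
  by (simp add: P_def)

lemma K_xi: "X \<in> VF \<Longrightarrow> Y \<in> VF \<Longrightarrow> K X \<xi> Y p = - ip (P X) Y p + ip X (phi Y) p"
  by (simp add: nabla_xi ip_phi)

lemma K_xi_xi: "X \<in> VF \<Longrightarrow> K X \<xi> \<xi> p = 0"
  using metric_at[of X \<xi> \<xi> p] by simp

lemma d_eta_at:
  assumes "X \<in> VF" "Y \<in> VF"
  shows "2 * ip X (phi Y) p = X p (ip Y \<xi>) - Y p (ip X \<xi>) - ip (lie_bracket X Y) \<xi> p"
  unfolding d_eta[OF assms, symmetric] using assms
  by (simp add: ext_deriv_def eta_field deriv_along_def)

lemma P_sym:
  assumes "X \<in> VF" "Y \<in> VF"
  shows "ip (P X) Y p = ip X (P Y) p"
proof -
  have "2 * ip X (phi Y) p = K X \<xi> Y p - K Y \<xi> X p"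
    using d_eta_at[OF assms, of p] assms by (simp add: metric_at bracket_ip)
  moreover have "ip Y (phi X) p = - ip X (phi Y) p"
    using ip_phi[OF assms, of p] assms ip_sym[of "phi X" Y] by simp
  ultimately show ?thesis using assms by (simp add: K_xi ip_sym[of "P Y" X])
qed

lemma eta_P [simp]: "X \<in> VF \<Longrightarrow> ip (P X) \<xi> = (\<lambda>_. 0)"
  using K_xi[of X \<xi>] K_xi_xi[of X] by (simp add: fun_eq_iff)

lemma P_xi [simp]: "P \<xi> = 0"
  by (rule field_eqI_global) (simp_all add: P_sym, simp add: ip_sym[of \<xi>])

lemma P_diff: "X \<in> VF \<Longrightarrow> Y \<in> VF \<Longrightarrow> P (X - Y) = P X - P Y"
  by (rule field_eqI_global) (simp_all add: P_sym)

lemma P_zero [simp]: "P 0 = 0"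
  using P_diff[of 0 0] by simp

lemma P_scaleR: "X \<in> VF \<Longrightarrow> P (c *\<^sub>R X) = c *\<^sub>R P X"
  by (rule field_eqI_global) (simp_all add: P_sym)

lemma P_add: "X \<in> VF \<Longrightarrow> Y \<in> VF \<Longrightarrow> P (X + Y) = P X + P Y"
  by (rule field_eqI_global) (simp_all add: P_sym)

text \<open>Symmetry replaces the usual partition of unity argument for tensoriality: if \<open>X p = 0\<close>
  then $|PX|^2 = g(X, P^2 X)$ vanishes at \<open>p\<close>.\<close>

lemma P_pointwise:
  assumes "X \<in> VF" "Y \<in> VF" "X p = Y p"
  shows "P X p = P Y p"
proof -
  let ?D = "X - Y"
  have "?D p = 0" using assms by simp
  then have "ip ?D (P (P ?D)) p = ip 0 (P (P ?D)) p" by (simp add: app2_def)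
  then have "ip (P ?D) (P ?D) p = 0" using assms by (simp add: P_sym)
  then have "P ?D p = 0" using assms ip_zero_imp[of "P ?D" p] by simp
  then show ?thesis using assms by (simp add: P_diff)
qed

lemma bracket_at: "lie_bracket X Y p f = X p (deriv_along Y f) - Y p (deriv_along X f)"
  by (simp add: lie_bracket_def)

lemma deriv_along_at: "deriv_along X f p = X p f"
  by (simp add: deriv_along_def)

lemma jacobi:
  assumes "X \<in> VF" "Y \<in> VF" "Z \<in> VF"
  shows "lie_bracket (lie_bracket X Y) Z + lie_bracket (lie_bracket Y Z) X + lie_bracket (lie_bracket Z X) Y = 0"
proof (rule ext, rule ext)
  fix p f
  have nonsmooth: "W q f = 0" if "f \<notin> smooth_funs A" "W \<in> VF" for W q
    using VF_Tan[OF that(2)] that(1) unfolding tangent_space_def by blast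
  show "(lie_bracket (lie_bracket X Y) Z + lie_bracket (lie_bracket Y Z) X + lie_bracket (lie_bracket Z X) Y) p f
      = 0 p f"
  proof (cases "f \<in> smooth_funs A")
    case True
    have b: "W p (deriv_along (lie_bracket U V) f) = W p (deriv_along U (deriv_along V f)) - W p (deriv_along V (deriv_along U f))"
      if "U \<in> VF" "V \<in> VF" "W \<in> VF" for U V W
    proof -
      have "deriv_along (lie_bracket U V) f = deriv_along U (deriv_along V f) - deriv_along V (deriv_along U f)"
        by (simp add: deriv_along_def lie_bracket_def fun_eq_iff)
      then show ?thesis using derivation_diff[OF that(3)] that True by simp
    qed
    show ?thesis
      using assms by (simp add: bracket_at b)
  next
    case False
    then show ?thesis using assms by (simp add: nonsmooth)
  qed
qed

text \<open>This is $d(d\eta) = 0$: the three derivatives of the fundamental form \<open>g(X, \<phi> Y)\<close> are written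
  with the connection, whose remaining terms cancel by torsion-freeness.\<close>

lemma T_cyclic:
  assumes "X \<in> VF" "Y \<in> VF" "Z \<in> VF"
  shows "T X Y Z p + T Y Z X p + T Z X Y p = 0"
proof -
  have d: "2 * W p (ip U (phi V)) = W p (deriv_along U (ip V \<xi>)) - W p (deriv_along V (ip U \<xi>)) - W p (ip (lie_bracket U V) \<xi>)"
    if "U \<in> VF" "V \<in> VF" "W \<in> VF" for U V W
  proof -
    have "2 *\<^sub>R ip U (phi V) = deriv_along U (ip V \<xi>) - deriv_along V (ip U \<xi>) - ip (lie_bracket U V) \<xi>"
      using d_eta_at[OF that(1,2)] by (simp add: fun_eq_iff deriv_along_def)
    moreover have "W p (2 *\<^sub>R ip U (phi V)) = 2 * W p (ip U (phi V))"
      using that by (simp only: derivation_scaleR ip_smooth phi_VF)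
    moreover have "deriv_along U (ip V \<xi>) - deriv_along V (ip U \<xi>) \<in> smooth_funs A"
    proof -
      have "deriv_along U (ip V \<xi>) + (-1) *\<^sub>R deriv_along V (ip U \<xi>) \<in> smooth_funs A"
        using that by (intro smooth_funs_add smooth_funs_scaleR atlas) auto
      moreover have "deriv_along U (ip V \<xi>) + (-1) *\<^sub>R deriv_along V (ip U \<xi>) =
          deriv_along U (ip V \<xi>) - deriv_along V (ip U \<xi>)" by (simp add: fun_eq_iff)
      ultimately show ?thesis by metis
    qed
    ultimately show ?thesis using that by (simp add: derivation_diff)
  qed
  have e: "2 * ip (lie_bracket U V) (phi W) p = U p (deriv_along V (ip W \<xi>)) - V p (deriv_along U (ip W \<xi>))
      - W p (ip (lie_bracket U V) \<xi>) - ip (lie_bracket (lie_bracket U V) W) \<xi> p"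
    if "U \<in> VF" "V \<in> VF" "W \<in> VF" for U V W
    using d_eta_at[of "lie_bracket U V" W p] that by (simp add: bracket_at)
  have j: "ip (lie_bracket (lie_bracket X Y) Z) \<xi> p + ip (lie_bracket (lie_bracket Y Z) X) \<xi> p
      + ip (lie_bracket (lie_bracket Z X) Y) \<xi> p = 0"
    using arg_cong[OF jacobi[OF assms], of "\<lambda>W. ip W \<xi> p"] assms by simp
  have dd: "Z p (ip X (phi Y)) + X p (ip Y (phi Z)) + Y p (ip Z (phi X)) =
      ip (lie_bracket X Y) (phi Z) p + ip (lie_bracket Y Z) (phi X) p + ip (lie_bracket Z X) (phi Y) p"
    using d[of X Y Z] d[of Y Z X] d[of Z X Y] e[of X Y Z] e[of Y Z X] e[of Z X Y] j assms
    by linarith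
  have m: "W p (ip U (phi V)) = K W U (phi V) p + K W (phi V) U p" if "U \<in> VF" "V \<in> VF" "W \<in> VF" for U V W
    using that by (simp add: metric_at)
  have s: "T U V W p = - T U W V p" if "U \<in> VF" "V \<in> VF" "W \<in> VF" for U V W
  proof -
    have "ip (phi V) W = (\<lambda>q. - ip V (phi W) q)" using that by (simp add: ip_phi fun_eq_iff)
    then have "ip (phi V) W = (-1) *\<^sub>R ip V (phi W)" by (simp add: fun_eq_iff)
    then have "U p (ip (phi V) W) = - U p (ip V (phi W))"
      using derivation_scaleR[of U "ip V (phi W)" p "-1"] that by simp
    then show ?thesis using that by (simp add: metric_at T_def)
  qed
  show ?thesis
    using dd s[of X Y Z] s[of Y Z X] s[of Z X Y] assms
    by (simp add: m bracket_ip T_def)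
qed

lemma T_skew:
  assumes "X \<in> VF" "Y \<in> VF" "Z \<in> VF"
  shows "T X Y Z p = - T X Z Y p"
proof -
  have "ip (phi Y) Z = (-1) *\<^sub>R ip Y (phi Z)" using assms by (simp add: ip_phi fun_eq_iff)
  then have "X p (ip (phi Y) Z) = - X p (ip Y (phi Z))"
    using derivation_scaleR[of X "ip Y (phi Z)" p "-1"] assms by simp
  then show ?thesis using assms by (simp add: metric_at T_def)
qed

lemma K_horizontal:
  assumes "X \<in> VF" "Y \<in> VF" "ip Y \<xi> = (\<lambda>_. 0)"
  shows "K X Y \<xi> p = - K X \<xi> Y p"
  using metric_at[of X Y \<xi> p] assms by simp

lemma T_xi:
  assumes "X \<in> VF" "Y \<in> VF"
  shows "T X Y \<xi> p = ip (P X) (phi Y) p + ip (phi X) (phi Y) p"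
  using assms by (simp add: T_def K_horizontal K_xi ip_phi[of X "phi Y"])

lemma T_xi_first:
  assumes "X \<in> VF" "Y \<in> VF"
  shows "T \<xi> X Y p = ip (phi (P X)) Y p + ip (P (phi X)) Y p"
proof -
  have "T \<xi> X Y p = - T X Y \<xi> p + T Y X \<xi> p"
    using T_cyclic[of \<xi> X Y p] T_skew[of Y \<xi> X p] assms by simp
  moreover have "ip (phi (P X)) Y p = - ip (P X) (phi Y) p" using assms by (simp add: ip_phi)
  moreover have "ip (P (phi X)) Y p = ip (P Y) (phi X) p"
    using assms by (simp add: P_sym[of "phi X"] ip_sym[of "P Y"])
  moreover have "ip (phi X) (phi Y) p = ip (phi Y) (phi X) p"
    using assms by (simp add: ip_sym[of "phi Y"])
  ultimately show ?thesis using assms by (simp add: T_xi)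
qed

lemma K_xi_first [simp]: "Y \<in> VF \<Longrightarrow> K \<xi> \<xi> Y p = 0"
  by (simp add: nabla_xi)

lemma P_phi_phi: "X \<in> VF \<Longrightarrow> P (phi (phi X)) = - P X"
  by (rule field_eqI_global) (simp_all add: P_sym phi_phi ip_sym[of \<xi> "P _"])

lemma phi_phi_P: "X \<in> VF \<Longrightarrow> phi (phi (P X)) = - P X"
  by (rule field_eqI_global) (simp_all add: phi_phi)

text \<open>Differentiating $\phi^2 = -I + \eta\otimes\xi$ along $\xi$ shows that $\nabla_\xi\phi$
  anticommutes with $\phi$, and by \<open>T_xi_first\<close> it equals $P\phi + \phi P$. Substituting gives
  $\phi P\phi = P$, that is $\phi P = -P\phi$; consequently $\nabla_\xi\phi = 0$.\<close>

lemma phi_P: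
  assumes "X \<in> VF"
  shows "phi (P X) = - P (phi X)"
proof -
  have conj: "ip (phi (P (phi X))) Y p = ip (P X) Y p" if Y: "Y \<in> VF" for Y p
  proof -
    have "K \<xi> (phi (phi X)) Y p = - K \<xi> X Y p + \<xi> p (ip X \<xi>) * ip Y \<xi> p"
      using assms Y by (simp add: phi_phi nabla_diff_right nabla_leibniz deriv_along_at ip_sym[of \<xi> Y])
    moreover have "K \<xi> X (phi (phi Y)) p = - K \<xi> X Y p + \<xi> p (ip X \<xi>) * ip Y \<xi> p"
      using assms Y metric_at[of \<xi> X \<xi> p] by (simp add: phi_phi)
    ultimately have "T \<xi> (phi X) Y p = T \<xi> X (phi Y) p" by (simp add: T_def)
    then have "ip (phi (P (phi X))) Y p + ip (P (phi (phi X))) Y p =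
        - ip (phi (phi (P X))) Y p - ip (phi (P (phi X))) Y p"
      using assms Y by (simp add: T_xi_first ip_phi)
    then show ?thesis using assms Y by (simp add: P_phi_phi phi_phi_P)
  qed
  show ?thesis
  proof (rule field_eqI_global)
    fix Z p assume Z: "Z \<in> VF"
    show "ip (phi (P X)) Z p = ip (- P (phi X)) Z p"
      using conj[of "phi Z" p] assms Z compat[of "P (phi X)" Z p] ip_phi[of "P X" Z p] by simp
  qed (use assms in auto)
qed

lemma nabla_xi_phi:
  assumes "X \<in> VF" "Y \<in> VF"
  shows "K \<xi> (phi X) Y p = - K \<xi> X (phi Y) p"
  using T_xi_first[OF assms, of p] assms by (simp add: T_def phi_P)

text \<open>In terms of the connection, $\mathcal L_\xi\phi$ is $\nabla_\xi\phi = 0$ plus the commutator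
  $[P, \phi] = 2 P\phi$.\<close>

lemma lie_derivative_phi:
  assumes "X \<in> VF"
  shows "lie_bracket \<xi> (phi X) - phi (lie_bracket \<xi> X) = 2 *\<^sub>R P (phi X)"
proof (rule field_eqI_global)
  fix Z p assume Z: "Z \<in> VF"
  show "ip (lie_bracket \<xi> (phi X) - phi (lie_bracket \<xi> X)) Z p = ip (2 *\<^sub>R P (phi X)) Z p"
    using assms Z ip_phi[OF P_VF[OF assms] Z, of p]
    by (simp add: bracket_ip ip_phi nabla_xi_phi K_xi phi_P)
qed (use assms in auto)

lemma contact_h_at:
  assumes "X \<in> VF"
  shows "contact_h A \<phi> \<xi> p (X p) = P (phi X) p"
proof -
  have "lie_deriv_endo A \<xi> \<phi> p (X p) = 2 *\<^sub>R P (phi X) p"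
    unfolding lie_deriv_endo_def
  proof (rule the_equality)
    \<comment> \<open>the common value for all extensions of the vector \<open>X p\<close> exists because \<open>P\<close> acts pointwise\<close>
    show "\<forall>Y\<in>VF. Y p = X p \<longrightarrow> 2 *\<^sub>R P (phi X) p = (lie_bracket \<xi> (phi Y) - phi (lie_bracket \<xi> Y)) p"
    proof (intro ballI impI)
      fix Y assume Y: "Y \<in> VF" "Y p = X p"
      have "phi X p = phi Y p" using Y(2) by (simp add: app_def)
      then have "P (phi X) p = P (phi Y) p" by (rule P_pointwise[OF phi_VF[OF assms] phi_VF[OF Y(1)]])
      then show "2 *\<^sub>R P (phi X) p = (lie_bracket \<xi> (phi Y) - phi (lie_bracket \<xi> Y)) p"
        using lie_derivative_phi[OF Y(1)] by simp
    qed
    fix w assume "\<forall>Y\<in>VF. Y p = X p \<longrightarrow> w = (lie_bracket \<xi> (phi Y) - phi (lie_bracket \<xi> Y)) p"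
    then show "w = 2 *\<^sub>R P (phi X) p" using assms fun_cong[OF lie_derivative_phi[OF assms], of p] by auto
  qed
  then show ?thesis by (simp add: contact_h_def)
qed

lemma contact_h_field: "X \<in> VF \<Longrightarrow> app (contact_h A \<phi> \<xi>) X = P (phi X)"
  by (simp add: app_def[of "contact_h A \<phi> \<xi>"] contact_h_at fun_eq_iff[of _ "P (phi X)"])

lemma phi_contact_h_at:
  assumes "X \<in> VF"
  shows "\<phi> p (contact_h A \<phi> \<xi> p (X p)) = P X p"
proof -
  have "phi (P (phi X)) = P X" using assms by (simp add: phi_P P_phi_phi)
  then show ?thesis using contact_h_at[OF assms, of p] by (metis app_def)
qed

text \<open>With $\nabla\xi = -S$ and $S = \phi + P$, this is
  $R(X,Y)\xi = -(\nabla_X S)Y + (\nabla_Y S)X$.\<close>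

lemma curvature_xi_ip:
  assumes "X \<in> VF" "Y \<in> VF" "Z \<in> VF"
  shows "ip (curvature nabla X Y \<xi>) Z p =
    - (K X (P Y) Z p - K X Y (P Z) p) + (K Y (P X) Z p - K Y X (P Z) p) - T X Y Z p + T Y X Z p"
  using assms
  by (simp add: curvature_def nabla_xi nabla_diff_right nabla_uminus_right P_sym ip_phi bracket_ip T_def)

text \<open>The cyclic identity combines the two terms with $\nabla\phi$ into a single one, in which the three
  arguments are permuted.\<close>

lemma curvature_xi_T:
  assumes "X \<in> VF" "Y \<in> VF" "Z \<in> VF"
  shows "T Z X Y p = (K X (P Y) Z p - K X Y (P Z) p) - (K Y (P X) Z p - K Y X (P Z) p)
    + ip (curvature nabla X Y \<xi>) Z p"
  using curvature_xi_ip[OF assms, of p] T_cyclic[OF assms, of p] T_skew[of Y X Z p] assms by simp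

lemma nijenhuis_ip:
  assumes "X \<in> VF" "Y \<in> VF" "Z \<in> VF"
  shows "ip (nijenhuis \<phi> X Y) Z p = T (phi X) Y Z p - T (phi Y) X Z p + T X Y (phi Z) p - T Y X (phi Z) p"
  using assms by (simp add: nijenhuis_def ip_phi bracket_ip T_def)

end

section \<open>Contact metric $(\kappa,\mu)$-manifolds\<close>

locale kappa_mu = contact_metric A n \<phi> \<xi> \<eta> g nabla
  for A :: "('a::{t2_space,second_countable_topology}, 'e::euclidean_space) atlas"
    and n :: nat and \<phi> \<xi> \<eta> g nabla +
  fixes \<kappa> \<mu> :: real
  assumes nullity: "X \<in> vector_fields A \<Longrightarrow> Y \<in> vector_fields A \<Longrightarrow> curvature nabla X Y \<xi> =
            \<kappa> *\<^sub>R (app \<eta> Y \<odot> X - app \<eta> X \<odot> Y) +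
            \<mu> *\<^sub>R (app \<eta> Y \<odot> app (contact_h A \<phi> \<xi>) X - app \<eta> X \<odot> app (contact_h A \<phi> \<xi>) Y)"
begin

lemma nullity_ip:
  assumes "X \<in> VF" "Y \<in> VF" "Z \<in> VF"
  shows "ip (curvature nabla X Y \<xi>) Z p =
    \<kappa> * (ip Y \<xi> p * ip X Z p - ip X \<xi> p * ip Y Z p) +
    \<mu> * (ip Y \<xi> p * ip (P (phi X)) Z p - ip X \<xi> p * ip (P (phi Y)) Z p)"
  using assms by (simp add: nullity eta_field contact_h_field)

text \<open>The operator $R(\cdot,\xi)\xi$ is $\nabla_\xi P - \phi^2 - P^2$. Evaluation on
  $(\phi X,\phi Z)$ instead of $(X,Z)$ reverses the signs of $\nabla_\xi P$ and of the $\mu$-term and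
  preserves the other terms, so the sum of the two equations expresses $P^2$ by $\phi^2$.\<close>

lemma P_P_ip:
  assumes "X \<in> VF" "Z \<in> VF"
  shows "ip (P X) (P Z) p = (1 - \<kappa>) * ip (phi X) (phi Z) p"
proof -
  define P' where "P' U W = K \<xi> (P U) W p - K \<xi> U (P W) p" for U W
  have l: "P' U W - ip (P U) (P W) p + ip (phi U) (phi W) p = \<kappa> * ip (phi U) (phi W) p + \<mu> * ip (P (phi U)) W p"
    if "U \<in> VF" "W \<in> VF" for U W
  proof -
    have "ip U (P (phi W)) p = ip (P (phi U)) W p"
      using that ip_phi[of "P U" W p] by (simp add: phi_P P_sym)
    moreover have "T \<xi> U W p = 0" using that by (simp add: T_def nabla_xi_phi)
    moreover have "T U \<xi> W p = ip (phi (P U)) W p - ip (phi U) (phi W) p"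
      using that T_skew[of U \<xi> W p] by (simp add: T_xi ip_phi[of "P U"])
    ultimately show ?thesis
      using curvature_xi_ip[of U \<xi> W p] nullity_ip[of U \<xi> W p] that
      by (simp add: P'_def K_xi compat ip_sym[of \<xi> W] ip_phi[of "P U"] ip_phi[of U] phi_P algebra_simps)
  qed
  have "P' (phi X) (phi Z) = - P' X Z"
  proof -
    have "K \<xi> (P X) (phi (phi Z)) p = - K \<xi> (P X) Z p"
      using assms by (simp add: phi_phi K_horizontal)
    moreover have "K \<xi> X (phi (phi (P Z))) p = - K \<xi> X (P Z) p"
      using assms by (simp add: phi_phi_P)
    moreover have "P (phi X) = - phi (P X)" "P (phi Z) = - phi (P Z)" using assms by (simp_all add: phi_P)
    ultimately show ?thesis
      unfolding P'_def using assms by (simp add: nabla_xi_phi nabla_uminus_right)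
  qed
  moreover have "ip (P (phi X)) (P (phi Z)) p = ip (P X) (P Z) p"
  proof -
    have "P (phi X) = - phi (P X)" "P (phi Z) = - phi (P Z)" using assms by (simp_all add: phi_P)
    then show ?thesis using assms by (simp add: compat)
  qed
  moreover have "ip (phi (phi X)) (phi (phi Z)) p = ip (phi X) (phi Z) p"
    using assms by (simp add: compat[of "phi X"])
  moreover have "ip (P (phi (phi X))) (phi Z) p = - ip (P (phi X)) Z p"
    using assms ip_phi[of "P X" Z p] by (simp add: P_phi_phi phi_P)
  ultimately show ?thesis
    using l[of X Z] l[of "phi X" "phi Z"] assms by (simp add: algebra_simps)
qed

lemma P_P:
  assumes "X \<in> VF"
  shows "P (P X) = (1 - \<kappa>) *\<^sub>R (X - ip X \<xi> \<odot> \<xi>)"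
proof (rule field_eqI_global)
  fix Z p assume "Z \<in> VF"
  then show "ip (P (P X)) Z p = ip ((1 - \<kappa>) *\<^sub>R (X - ip X \<xi> \<odot> \<xi>)) Z p"
    using assms P_P_ip[OF assms, of Z p] by (simp add: P_sym compat ip_sym[of \<xi> Z])
qed (use assms in auto)

text \<open>If \<open>P\<close> vanishes, the curvature identity reads
  $(\nabla_Z\phi)X = \kappa(g(X,Z)\xi - \eta(X)Z)$, whence
  $[\phi,\phi] = -2\kappa\,d\eta\otimes\xi$. Moreover $P^2 = (\kappa-1)\phi^2$ shows that
  $(1-\kappa)\,d\eta = 0$, so that $\kappa$ can be replaced by \<open>1\<close>.\<close>

lemma sasakian_if_P_zero:
  assumes "\<And>X. X \<in> VF \<Longrightarrow> P X = 0"
  shows "sasakian A n \<phi> \<xi> \<eta> g"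
  unfolding sasakian_def
proof (intro conjI ballI contact)
  fix X Y assume X: "X \<in> VF" and Y: "Y \<in> VF"
  have T: "T W U V p = \<kappa> * (ip V \<xi> p * ip U W p - ip U \<xi> p * ip V W p)"
    if "U \<in> VF" "V \<in> VF" "W \<in> VF" for U V W p
    using curvature_xi_T[OF that, of p] nullity_ip[OF that, of p] that by (simp add: assms)
  have N: "nijenhuis \<phi> X Y \<in> VF" using X Y by (simp add: nijenhuis_def)
  have s: "2 *\<^sub>R ip X (phi Y) \<in> smooth_funs A" using X Y by (intro smooth_funs_scaleR atlas) auto
  show "nijenhuis \<phi> X Y + (2 *\<^sub>R ext_deriv \<eta> X Y) \<odot> \<xi> = 0"
    unfolding d_eta[OF X Y]
  proof (rule field_eqI_global)
    fix Z p assume Z: "Z \<in> VF"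
    have k: "(1 - \<kappa>) * ip X (phi Y) p = 0"
      using P_P_ip[of X "phi Y" p] X Y by (simp add: assms phi_phi ip_phi)
    have "ip (nijenhuis \<phi> X Y) Z p = - 2 * \<kappa> * ip Z \<xi> p * ip X (phi Y) p"
      using X Y Z ip_phi[OF X Y, of p] ip_phi[OF X Z, of p] ip_phi[OF Y Z, of p]
        ip_sym[of Y "phi X"] ip_sym[of "phi Z"] ip_sym[of Z "phi X"] ip_sym[of Z "phi Y"] ip_sym[of "phi Y" X]
      by (simp add: nijenhuis_ip T algebra_simps)
    then show "ip (nijenhuis \<phi> X Y + (2 *\<^sub>R ip X (phi Y)) \<odot> \<xi>) Z p = ip 0 Z p"
      using k X Y Z N s by (simp add: ip_sym[of \<xi> Z] algebra_simps)
  qed (use N s in auto)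
qed

text \<open>For \<open>X\<close>, \<open>Y\<close> in one eigendistribution of \<open>P\<close> and \<open>Z\<close> in the opposite one, the curvature identity
  reads $2s\,g([X,Y],Z) = g((\nabla_Z\phi)X,Y)$. The right-hand side changes sign under
  $(X,Y) \mapsto (\phi X,\phi Y)$, which moves all three arguments into the same eigendistribution; there
  the identity shows that it vanishes.\<close>

lemma eigenfields_involutive:
  assumes X: "X \<in> VF" "P X = s *\<^sub>R X" and Y: "Y \<in> VF" "P Y = s *\<^sub>R Y"
    and s: "s \<noteq> 0" "s\<^sup>2 = 1 - \<kappa>"
  shows "P (lie_bracket X Y) = s *\<^sub>R lie_bracket X Y"
proof -
  have eta0: "ip U \<xi> = (\<lambda>_. 0)" if "U \<in> VF" "P U = t *\<^sub>R U" "t \<noteq> 0" for U t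
  proof
    fix p
    have "t * ip U \<xi> p = ip (P U) \<xi> p" using that by (simp add: that(2) del: eta_P)
    then show "ip U \<xi> p = 0" using that(1,3) by simp
  qed
  have eigen_phi: "P (phi U) = (- t) *\<^sub>R phi U" if "U \<in> VF" "P U = t *\<^sub>R U" for U t
  proof (rule field_eqI_global)
    fix Z p assume Z: "Z \<in> VF"
    show "ip (P (phi U)) Z p = ip ((- t) *\<^sub>R phi U) Z p"
      using arg_cong[OF phi_P[OF that(1)], of "\<lambda>W. ip W Z p"] that Z by (simp add: that(2) ip_phi)
  qed (use that in auto)
  define W where "W = lie_bracket X Y"
  have W: "W \<in> VF" using X Y by (simp add: W_def)
  have flat: "T U V Z p = K V (P Z) U p - K V Z (P U) p - (K Z (P V) U p - K Z V (P U) p)"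
    if "U \<in> VF" "V \<in> VF" "Z \<in> VF" "ip V \<xi> = (\<lambda>_. 0)" "ip Z \<xi> = (\<lambda>_. 0)" for U V Z p
    using curvature_xi_T[of V Z U p] nullity_ip[of V Z U p] that by simp
  have orth: "ip W Z p = 0" if Z: "Z \<in> VF" "P Z = (- s) *\<^sub>R Z" for Z p
  proof -
    have h: "ip X \<xi> = (\<lambda>_. 0)" "ip Y \<xi> = (\<lambda>_. 0)" using eta0 X Y s by blast+
    have "T Z (phi X) (phi Y) p = 0"
      using flat[of Z "phi X" "phi Y" p] X Y Z by (simp add: eigen_phi[of X s] eigen_phi[of Y s] Z(2) nabla_scaleR_right nabla_uminus_right)
    moreover have "T Z (phi X) (phi Y) p = - T Z X Y p"
    proof -
      have "phi (phi X) = - X" "phi (phi Y) = - Y"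
        using X Y h by (simp_all add: phi_phi fsmul_def fun_eq_iff)
      then show ?thesis using X Y Z by (simp add: T_def nabla_uminus_right)
    qed
    moreover have "T Z X Y p = 2 * s * ip W Z p"
      using flat[of Z X Y p] X Y Z h
      by (simp add: X(2) Y(2) Z(2) nabla_scaleR_right W_def bracket_ip algebra_simps)
    ultimately show ?thesis using s by simp
  qed
  have hW: "ip W \<xi> p = 0" for p
  proof -
    have h: "ip X \<xi> = (\<lambda>_. 0)" "ip Y \<xi> = (\<lambda>_. 0)" using eta0 X Y s by blast+
    have "s * ip X (phi Y) p = ip (P X) (phi Y) p" using X Y by (simp add: X(2))
    also have "\<dots> = ip X (P (phi Y)) p" by (rule P_sym) (use X Y in auto)
    also have "\<dots> = - s * ip X (phi Y) p" using X Y eigen_phi[OF Y] by simp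
    finally have "ip X (phi Y) p = 0" using s by simp
    then show ?thesis using d_eta_at[OF X(1) Y(1), of p] X Y h by (simp add: W_def)
  qed
  \<comment> \<open>the defect \<open>?Z\<close> lies in the opposite eigendistribution, so it is orthogonal to \<open>W\<close> and then to itself\<close>
  let ?Z = "P W - s *\<^sub>R W"
  have "P ?Z = (- s) *\<^sub>R ?Z"
  proof -
    have "P (P W) = s\<^sup>2 *\<^sub>R W"
      using W hW by (simp add: P_P s fsmul_def fun_eq_iff[of _ W] fun_eq_iff)
    then show ?thesis using W by (simp add: P_diff P_scaleR power2_eq_square algebra_simps)
  qed
  then have "ip W ?Z p = 0" "ip W (P ?Z) p = 0" for p
    using W orth[of ?Z] by simp_all
  then have "ip ?Z ?Z p = 0" for p
    using W P_sym[of W ?Z p] by (simp del: ip_diff_right)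
  then have "?Z p = 0" for p using W ip_zero_imp[of ?Z p] by (simp del: ip_diff_right ip_left)
  then show ?thesis by (simp add: W_def fun_eq_iff[of _ "_ *\<^sub>R lie_bracket X Y"])
qed

end


section \<open>The eigenspaces in one tangent space\<close>

lemma linear_map_on_diff:
  assumes "linear_map_on V L" "subspace V" "v \<in> V" "w \<in> V"
  shows "L (v - w) = L v - L w"
proof -
  have "L (v - w) + L w = L v"
    using linear_map_onD(1)[OF assms(1) subspace_diff[OF assms(2,3,4)] assms(4)] by simp
  then show ?thesis by (simp add: eq_diff_eq)
qed

lemma linear_map_on_zero:
  assumes "linear_map_on V L" "subspace V"
  shows "L 0 = 0"
  using linear_map_on_diff[OF assms subspace_0[OF assms(2)] subspace_0[OF assms(2)]] by simp

lemma direct_sum3I: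
  assumes "subspace X" "subspace Y" "subspace Z" "X \<subseteq> V" "Y \<subseteq> V" "Z \<subseteq> V"
    and ex: "\<And>v. v \<in> V \<Longrightarrow> \<exists>x\<in>X. \<exists>y\<in>Y. \<exists>z\<in>Z. v = x + y + z"
    and indep: "\<And>x y z. x \<in> X \<Longrightarrow> y \<in> Y \<Longrightarrow> z \<in> Z \<Longrightarrow> x + y + z = 0 \<Longrightarrow> x = 0 \<and> y = 0 \<and> z = 0"
  shows "direct_sum3 V X Y Z"
  unfolding direct_sum3_def
proof (intro conjI ballI assms(1-6))
  fix v assume "v \<in> V"
  then obtain x y z where xyz: "x \<in> X" "y \<in> Y" "z \<in> Z" "v = x + y + z" using ex by blast
  show "\<exists>!(x, y, z). x \<in> X \<and> y \<in> Y \<and> z \<in> Z \<and> v = x + y + z"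
  proof (rule ex1I[of _ "(x, y, z)"])
    show "case (x, y, z) of (x, y, z) \<Rightarrow> x \<in> X \<and> y \<in> Y \<and> z \<in> Z \<and> v = x + y + z" using xyz by simp
    fix q assume "case q of (x, y, z) \<Rightarrow> x \<in> X \<and> y \<in> Y \<and> z \<in> Z \<and> v = x + y + z"
    then obtain x' y' z' where q: "q = (x', y', z')" "x' \<in> X" "y' \<in> Y" "z' \<in> Z" "v = x' + y' + z'"
      by (cases q) auto
    have "(x - x') + (y - y') + (z - z') = 0" using xyz(4) q(5) by (simp add: algebra_simps)
    then have "x - x' = 0 \<and> y - y' = 0 \<and> z - z' = 0"
      using xyz q assms(1-3) by (intro indep subspace_diff) auto
    then show "q = (x, y, z)" using q(1) by simp
  qed
qed

text \<open>Tangent spaces live in the infinite-dimensional space of functionals; dimensions are computed after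
  transport to a Euclidean space.\<close>

lemma dim_image_inj:
  fixes L :: "'v::real_vector \<Rightarrow> 'w::real_vector"
  assumes "linear L" "inj_on L V" "subspace V" "S \<subseteq> V"
  shows "dim (L ` S) = dim S"
proof -
  obtain B where B: "B \<subseteq> S" "independent B" "S \<subseteq> span B" "card B = dim S"
    using basis_exists by blast
  have "span B \<subseteq> V" using B(1) assms(3,4) by (meson order_trans span_minimal)
  then have i: "inj_on L (span B)" using assms(2) inj_on_subset by blast
  have "independent (L ` B)" by (rule linear_independent_injective_image[OF assms(1) B(2) i])
  moreover have "L ` S \<subseteq> span (L ` B)" using B(3) linear_span_image[OF assms(1)] by blast
  ultimately have "dim (L ` S) = card (L ` B)"
    using B(1) by (metis basis_card_eq_dim image_mono)
  also have "\<dots> = card B" by (rule card_image) (meson i inj_on_subset span_superset)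
  finally show ?thesis using B(4) by simp
qed

lemma dim_zero_space: "dim {0 :: 'v::real_vector} = 0"
  using dim_le_card[of "{0::'v}" "{}"] by simp

text \<open>The situation in a tangent space: \<open>J\<close> is $\phi$, \<open>P\<close> is $\phi h$, so that $h = P J$, and \<open>z\<close> is
  the Reeb vector.\<close>

locale contact_vector_space =
  fixes V :: "'v::real_vector set" and J P :: "'v \<Rightarrow> 'v" and z :: 'v and e :: "'v \<Rightarrow> real" and lam :: real
  assumes V: "subspace V" and z [simp]: "z \<in> V"
    and J_lin: "linear_map_on V J" and P_lin: "linear_map_on V P" and e_lin: "linear_map_on V e"
    and J_V [simp]: "v \<in> V \<Longrightarrow> J v \<in> V" and P_V [simp]: "v \<in> V \<Longrightarrow> P v \<in> V"
    and e_z [simp]: "e z = 1" and e_J [simp]: "v \<in> V \<Longrightarrow> e (J v) = 0" and e_P [simp]: "v \<in> V \<Longrightarrow> e (P v) = 0"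
    and P_z [simp]: "P z = 0"
    and J_J: "v \<in> V \<Longrightarrow> J (J v) = - v + e v *\<^sub>R z"
    and J_P: "v \<in> V \<Longrightarrow> J (P v) = - P (J v)"
    and P_P: "v \<in> V \<Longrightarrow> P (P v) = lam\<^sup>2 *\<^sub>R (v - e v *\<^sub>R z)"
    and lam_pos: "0 < lam"
begin

definition E :: "real \<Rightarrow> 'v set" where "E s = {v \<in> V. P v = s *\<^sub>R v}"
definition H :: "real \<Rightarrow> 'v set" where "H t = {v \<in> V. P (J v) = t *\<^sub>R v}"

lemma V_closed [simp]:
  "v \<in> V \<Longrightarrow> w \<in> V \<Longrightarrow> v + w \<in> V" "v \<in> V \<Longrightarrow> w \<in> V \<Longrightarrow> v - w \<in> V"
  "v \<in> V \<Longrightarrow> c *\<^sub>R v \<in> V" "v \<in> V \<Longrightarrow> - v \<in> V" "0 \<in> V"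
  using V by (auto intro: subspace_add subspace_diff subspace_scale subspace_neg subspace_0)

lemma lin [simp]:
  assumes "v \<in> V" "w \<in> V"
  shows "J (v + w) = J v + J w" "J (c *\<^sub>R v) = c *\<^sub>R J v" "J (v - w) = J v - J w"
    "P (v + w) = P v + P w" "P (c *\<^sub>R v) = c *\<^sub>R P v" "P (v - w) = P v - P w"
    "e (v + w) = e v + e w" "e (c *\<^sub>R v) = c * e v" "e (v - w) = e v - e w"
    "J 0 = 0" "P 0 = 0" "e 0 = 0"
  using assms linear_map_onD[OF J_lin] linear_map_onD[OF P_lin] linear_map_onD[OF e_lin]
    linear_map_on_diff[OF J_lin V] linear_map_on_diff[OF P_lin V] linear_map_on_diff[OF e_lin V]
    linear_map_on_zero[OF J_lin V] linear_map_on_zero[OF P_lin V] linear_map_on_zero[OF e_lin V]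
  by auto

lemma lin_minus [simp]: "v \<in> V \<Longrightarrow> P (- v) = - P v" "v \<in> V \<Longrightarrow> J (- v) = - J v"
  using lin(5)[of v v "-1"] lin(2)[of v v "-1"] by auto

lemma subspace_E: "subspace (E s)"
  by (auto simp: subspace_def E_def algebra_simps lin[of z z])

lemma subspace_H: "subspace (H t)"
  by (auto simp: subspace_def H_def algebra_simps lin[of z z])

lemma E_horizontal: "s \<noteq> 0 \<Longrightarrow> v \<in> E s \<Longrightarrow> e v = 0"
  using e_P[of v] lin(8)[of v v s] by (auto simp: E_def)

lemma H_horizontal: "t \<noteq> 0 \<Longrightarrow> v \<in> H t \<Longrightarrow> e v = 0"
  using e_P[of "J v"] lin(8)[of v v t] by (auto simp: H_def)

lemma J_E: "v \<in> E s \<Longrightarrow> J v \<in> E (- s)"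
  using J_P[of v] by (auto simp: E_def)

lemma E_0: "E 0 = span {z}"
proof
  show "E 0 \<subseteq> span {z}"
  proof
    fix v assume v: "v \<in> E 0"
    then have "lam\<^sup>2 *\<^sub>R (v - e v *\<^sub>R z) = 0" using P_P[of v] lin(11)[of z z] by (auto simp: E_def)
    then have "v = e v *\<^sub>R z" using lam_pos by simp
    then show "v \<in> span {z}" by (metis span_base span_scale singletonI)
  qed
  show "span {z} \<subseteq> E 0" by (rule span_minimal[OF _ subspace_E]) (simp add: E_def)
qed

lemma eigenvalue_cases:
  assumes "v \<in> V" "v \<noteq> 0" "P v = c *\<^sub>R v"
  shows "c = 0 \<or> c = lam \<or> c = - lam"
proof (rule ccontr)
  assume c: "\<not> ?thesis"
  then have "e v = 0" using assms E_horizontal[of c v] by (auto simp: E_def)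
  then have "(c * c) *\<^sub>R v = lam\<^sup>2 *\<^sub>R v" using P_P[OF assms(1)] assms by simp
  then have "c\<^sup>2 = lam\<^sup>2" using assms(2) by (simp add: power2_eq_square)
  then show False using c by (simp add: power2_eq_iff)
qed

lemma graph_in_E:
  assumes "s\<^sup>2 = lam\<^sup>2" "v \<in> H s"
  shows "v + J v \<in> E s"
proof -
  have s: "s \<noteq> 0" using assms lam_pos by auto
  have vV: "v \<in> V" and PJ: "P (J v) = s *\<^sub>R v" using assms(2) by (auto simp: H_def)
  have "P (J (J v)) = s *\<^sub>R - J v"
    using J_P[of "J v"] PJ vV by (simp add: minus_equation_iff[of _ "J _"])
  then have "P v = s *\<^sub>R J v" using J_J[OF vV] H_horizontal[OF s assms(2)] vV by simp
  then show ?thesis using vV PJ by (simp add: E_def algebra_simps)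
qed

lemma E_in_graph:
  assumes "s \<noteq> 0" "v \<in> E s"
  defines "w \<equiv> (1/2) *\<^sub>R (v - J v)"
  shows "w \<in> H s" "v = w + J w"
proof -
  have vV: "v \<in> V" and Pv: "P v = s *\<^sub>R v" and h: "e v = 0"
    using assms(2) E_horizontal[OF assms(1,2)] by (auto simp: E_def)
  have JJ: "J (J v) = - v" using J_J[OF vV] h by simp
  have PJ: "P (J v) = - (s *\<^sub>R J v)" using J_P[OF vV] Pv vV by (simp add: minus_equation_iff[of _ "P _"])
  show "w \<in> H s" using vV by (simp add: w_def H_def JJ PJ Pv algebra_simps)
  show "v = w + J w" using vV by (simp add: w_def JJ algebra_simps flip: scaleR_add_left)
qed

lemma E_eq_graph:
  assumes "s\<^sup>2 = lam\<^sup>2"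
  shows "E s = {v + J v | v. v \<in> H s}"
proof -
  have "s \<noteq> 0" using assms lam_pos by auto
  then show ?thesis using graph_in_E[OF assms] E_in_graph by blast
qed

text \<open>\<open>J\<close> carries \<open>E (- lam)\<close> injectively into \<open>E lam\<close>, and \<open>P v\<close> is the sum of its components in the two.\<close>

lemma P_zero_if_E_trivial:
  assumes "E lam = {0}" "v \<in> V"
  shows "P v = 0"
proof -
  have triv: "x = 0" if x: "x \<in> E (- lam)" for x
  proof -
    have "x \<in> V" "e x = 0" using x E_horizontal[of "- lam" x] lam_pos by (auto simp: E_def)
    moreover have "J x = 0" using J_E[OF x] assms(1) by simp
    ultimately show ?thesis using J_J[of x] lin(10)[of z z] by simp
  qed
  let ?b = "(1/lam) *\<^sub>R P (P v)"
  have "P ?b = lam *\<^sub>R P v"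
    using assms(2) P_P[of "P v"] lam_pos by (simp add: power2_eq_square)
  then have plus: "P v + ?b \<in> E lam" and minus: "P v - ?b \<in> E (- lam)"
    using assms(2) lam_pos by (simp_all add: E_def algebra_simps)
  have "P v + ?b = 0" "P v - ?b = 0" using plus assms(1) triv[OF minus] by blast+
  then have "(P v + ?b) + (P v - ?b) = 0" by simp
  then have "2 *\<^sub>R P v = 0" by (simp add: scaleR_2)
  then show ?thesis by simp
qed

lemma E_H_trivial:
  assumes "s\<^sup>2 = lam\<^sup>2" "t\<^sup>2 = lam\<^sup>2" "x \<in> E s" "x \<in> H t"
  shows "x = 0"
proof -
  have s: "s \<noteq> 0" using assms lam_pos by auto
  have xV: "x \<in> V" and Px: "P x = s *\<^sub>R x" and PJ: "P (J x) = t *\<^sub>R x"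
    using assms by (auto simp: E_def H_def)
  have "e x = 0" using E_horizontal[OF s assms(3)] .
  have Jx: "s *\<^sub>R J x = - (t *\<^sub>R x)" using J_P[OF xV] xV by (simp add: Px PJ)
  have "s *\<^sub>R (s *\<^sub>R J (J x)) = s *\<^sub>R J (s *\<^sub>R J x)" using xV by simp
  also have "\<dots> = s *\<^sub>R J (- (t *\<^sub>R x))" by (simp only: Jx)
  also have "\<dots> = - (t *\<^sub>R (s *\<^sub>R J x))" using xV by (simp add: mult.commute)
  also have "\<dots> = t\<^sup>2 *\<^sub>R x" by (simp only: Jx) (simp add: power2_eq_square)
  finally have "- (s\<^sup>2 *\<^sub>R x) = t\<^sup>2 *\<^sub>R x"
    using J_J[OF xV] \<open>e x = 0\<close> by (simp add: power2_eq_square)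
  then have "(s\<^sup>2 + t\<^sup>2) *\<^sub>R x = 0" by (simp only: scaleR_add_left) (metis add.right_inverse)
  then show ?thesis using assms(1,2) lam_pos by simp
qed

text \<open>On the kernel of \<open>e\<close>, the maps $\sigma = P/s$ and $\tau = PJ/t$ are anticommuting involutions. The
  component of \<open>u\<close> in \<open>E s\<close> along \<open>H t\<close> is $\frac12(1+\sigma)(1-\tau)u$: it is fixed by $\sigma$, and
  its difference from \<open>u\<close> is fixed by $\tau$ because $(1-\tau)(1+\sigma)(1-\tau) = 2(1-\tau)$.\<close>

lemma E_H_decomposition:
  assumes s2: "s\<^sup>2 = lam\<^sup>2" and t2: "t\<^sup>2 = lam\<^sup>2" and u: "u \<in> V" "e u = 0"
  shows "\<exists>x\<in>E s. u - x \<in> H t"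
proof -
  have s: "s \<noteq> 0" and t: "t \<noteq> 0" using assms lam_pos by auto
  define a b c where "a = P (J u)" and "b = P u" and "c = J u"
  have V: "a \<in> V" "b \<in> V" "c \<in> V" using u by (auto simp: a_def b_def c_def)
  have "lam\<^sup>2 = s * s" using s2 by (simp add: power2_eq_square)
  then have Pb: "P b = (s * s) *\<^sub>R u" and Pa: "P a = (s * s) *\<^sub>R c"
    using u by (simp_all add: a_def b_def c_def P_P)
  have ops: "P u = b" "P c = a" "J u = c" by (simp_all add: a_def b_def c_def)
  have Jc: "J c = - u" using u J_J[of u] by (simp add: c_def)
  have Jb: "J b = - a" using u J_P[of u] by (simp add: a_def b_def)
  have Ja: "J a = b" using u J_P[of "J u"] J_J[of u] by (simp add: a_def b_def)
  let ?x = "(1/2) *\<^sub>R u - (1/(2 * t)) *\<^sub>R a + (1/(2 * s)) *\<^sub>R b - (s/(2 * t)) *\<^sub>R c"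
  have Px: "P ?x = (1/2) *\<^sub>R b - (1/(2 * t)) *\<^sub>R ((s * s) *\<^sub>R c) + (1/(2 * s)) *\<^sub>R ((s * s) *\<^sub>R u) - (s/(2 * t)) *\<^sub>R a"
    using u V by (simp add: Pa Pb ops)
  have "?x \<in> E s"
    using u V s by (simp only: E_def Px mem_Collect_eq) (simp add: algebra_simps)
  moreover have "u - ?x \<in> H t"
  proof -
    have st: "s * s = t * t" using s2 t2 by (simp add: power2_eq_square)
    have "P (J ?x) = (1/2) *\<^sub>R a - (1/(2 * t)) *\<^sub>R ((s * s) *\<^sub>R u) + (1/(2 * s)) *\<^sub>R (- ((s * s) *\<^sub>R c)) - (s/(2 * t)) *\<^sub>R (- b)"
      using u V by (simp add: Ja Jb Jc Pa Pb ops)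
    also have "\<dots> = (1/2) *\<^sub>R a - (t/2) *\<^sub>R u - (s/2) *\<^sub>R c + (s/(2 * t)) *\<^sub>R b"
      using s t by (simp add: st[symmetric]) (simp add: st)
    finally have PJx: "P (J ?x) = (1/2) *\<^sub>R a - (t/2) *\<^sub>R u - (s/2) *\<^sub>R c + (s/(2 * t)) *\<^sub>R b" .
    have "t *\<^sub>R ?x = (t/2) *\<^sub>R u - (1/2) *\<^sub>R a + (t/(2 * s)) *\<^sub>R b - (s/2) *\<^sub>R c"
      using t by (simp add: algebra_simps)
    moreover have "t/(2 * s) = s/(2 * t)" using s t st by (simp add: field_simps)
    ultimately have tx: "t *\<^sub>R ?x = (t/2) *\<^sub>R u - (1/2) *\<^sub>R a + (s/(2 * t)) *\<^sub>R b - (s/2) *\<^sub>R c" by simp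
    have halves: "a = (1/2) *\<^sub>R a + (1/2) *\<^sub>R a" "t *\<^sub>R u = (t/2) *\<^sub>R u + (t/2) *\<^sub>R u"
      by (simp_all flip: scaleR_add_left)
    have "P (J (u - ?x)) = a - P (J ?x)" using u V by (simp add: a_def)
    also have "\<dots> = ((1/2) *\<^sub>R a + (1/2) *\<^sub>R a) - P (J ?x)" using halves(1) by metis
    also have "\<dots> = ((t/2) *\<^sub>R u + (t/2) *\<^sub>R u) - t *\<^sub>R ?x"
      unfolding PJx tx by simp
    also have "\<dots> = t *\<^sub>R u - t *\<^sub>R ?x" using halves(2) by metis
    finally have "P (J (u - ?x)) = t *\<^sub>R u - t *\<^sub>R ?x" .
    then show ?thesis using u V by (simp add: H_def algebra_simps)
  qed
  ultimately show ?thesis by blast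
qed

lemma transversal_E_H:
  assumes s: "s\<^sup>2 = lam\<^sup>2" and t: "t\<^sup>2 = lam\<^sup>2"
  shows "direct_sum3 V (E s) (H t) (span {z})"
proof (rule direct_sum3I)
  have nz: "s \<noteq> 0" "t \<noteq> 0" using assms lam_pos by auto
  show "span {z} \<subseteq> V" by (rule span_minimal) (auto simp: V)
  fix v assume v: "v \<in> V"
  then obtain x where x: "x \<in> E s" "(v - e v *\<^sub>R z) - x \<in> H t"
    using E_H_decomposition[OF s t, of "v - e v *\<^sub>R z"] by auto
  moreover have "v = x + ((v - e v *\<^sub>R z) - x) + e v *\<^sub>R z" by simp
  moreover have "e v *\<^sub>R z \<in> span {z}" by (simp add: span_base span_scale)
  ultimately show "\<exists>x\<in>E s. \<exists>y\<in>H t. \<exists>w\<in>span {z}. v = x + y + w" by blast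
next
  have nz: "s \<noteq> 0" "t \<noteq> 0" using assms lam_pos by auto
  fix x y w assume xyw: "x \<in> E s" "y \<in> H t" "w \<in> span {z}" "x + y + w = 0"
  then obtain c where c: "w = c *\<^sub>R z" by (auto simp: span_singleton)
  have m: "x \<in> V" "y \<in> V" using xyw by (auto simp: E_def H_def)
  have "e (x + y + w) = c" using m c E_horizontal[OF nz(1) xyw(1)] H_horizontal[OF nz(2) xyw(2)] by simp
  then have "w = 0" using xyw(4) c lin(12)[of z z] by simp
  then have "x = - y" using xyw(4) by (simp add: add_eq_0_iff2)
  then have "x \<in> H t" using subspace_neg[OF subspace_H xyw(2)] by simp
  then have "x = 0" using E_H_trivial[OF s t xyw(1)] by simp
  then show "x = 0 \<and> y = 0 \<and> w = 0" using \<open>w = 0\<close> \<open>x = - y\<close> by simp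
next
  show "subspace (E s)" "subspace (H t)" "subspace (span {z})"
    by (rule subspace_E subspace_H subspace_span)+
  show "E s \<subseteq> V" "H t \<subseteq> V" by (auto simp: E_def H_def)
qed

text \<open>\<open>J\<close> exchanges \<open>E s\<close> and \<open>E (- s)\<close>, which together with \<open>z\<close> span \<open>V\<close>.\<close>

lemma dim_E:
  fixes L :: "'v \<Rightarrow> 'e::euclidean_space"
  assumes L: "linear L" "inj_on L V" "L ` V = UNIV" and n: "DIM('e) = 2 * n + 1" and s: "s\<^sup>2 = lam\<^sup>2"
  shows "dim (E s) = n"
proof -
  have EV: "E t \<subseteq> V" for t by (auto simp: E_def)
  have dL: "dim (L ` E t) = dim (E t)" for t by (rule dim_image_inj[OF L(1,2) V EV])
  have sub: "subspace (L ` E t)" for t by (rule linear_subspace_image[OF L(1) subspace_E])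
  have le: "dim (E (- t)) \<le> dim (E t)" if t: "t \<noteq> 0" for t
  proof -
    obtain B where B: "B \<subseteq> E t" "independent B" "E t \<subseteq> span B" "card B = dim (E t)"
      using basis_exists by blast
    have BV: "span B \<subseteq> V" using B(1) EV V by (meson order_trans span_minimal)
    have "independent (L ` B)"
      by (rule linear_independent_injective_image[OF L(1) B(2) inj_on_subset[OF L(2) BV]])
    then have fin: "finite B"
      using independent_imp_finite finite_imageD inj_on_subset[OF L(2) order_trans[OF span_superset BV]] by blast
    have "subspace {x \<in> V. J x \<in> span (J ` B)}"
      by (auto simp: subspace_def lin[of z z] span_add span_scale span_zero)
    then have JB: "span B \<subseteq> {x \<in> V. J x \<in> span (J ` B)}"
      by (rule span_minimal[rotated]) (use B(1) EV span_base in \<open>auto intro: span_base\<close>)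
    have "E (- t) \<subseteq> span (J ` B)"
    proof
      fix y assume y: "y \<in> E (- t)"
      then have yV: "y \<in> V" and "e y = 0" using E_horizontal[of "- t" y] t EV by auto
      then have "J (J y) = - y" using J_J by simp
      moreover have "J y \<in> E t" using J_E[OF y] by simp
      then have "J (J y) \<in> span (J ` B)" using B(3) JB by blast
      ultimately show "y \<in> span (J ` B)" using span_neg by force
    qed
    then have "dim (E (- t)) \<le> card (J ` B)" using fin by (intro dim_le_card) auto
    also have "\<dots> \<le> card B" by (rule card_image_le[OF fin])
    finally show ?thesis using B(4) by simp
  qed
  have s0: "s \<noteq> 0" using s lam_pos by auto
  have eq: "dim (E (- s)) = dim (E s)" using le[of s] le[of "- s"] s0 by simp
  have triv: "x = 0" if "x \<in> E s" "x \<in> E (- s)" for x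
  proof -
    have "(s + s) *\<^sub>R x = s *\<^sub>R x - (- s) *\<^sub>R x" by (simp only: scaleR_add_left scaleR_minus_left diff_minus_eq_add)
    also have "\<dots> = 0" using that by (simp add: E_def)
    finally show ?thesis using s0 by simp
  qed
  let ?S = "{x + y |x y. x \<in> L ` E s \<and> y \<in> L ` E (- s)}"
  have "L ` E s \<inter> L ` E (- s) = {0}"
  proof -
    have "y = 0" if y: "y \<in> L ` E s" "y \<in> L ` E (- s)" for y
    proof -
      obtain a where a: "y = L a" "a \<in> E s" using y(1) by blast
      obtain b where b: "y = L b" "b \<in> E (- s)" using y(2) by blast
      note ab = a b
      then have "a = b" using L(2) EV by (metis inj_on_contraD subsetD)
      then have "a = 0" using triv[of a] ab by simp
      then show ?thesis using a(1) linear_0[OF L(1)] by simp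
    qed
    then show ?thesis using subspace_0[OF sub] by auto
  qed
  then have dS: "dim ?S = 2 * dim (E s)"
    using dim_sums_Int[OF sub[of s] sub[of "- s"]] by (simp add: dL eq)
  have subS: "subspace ?S" by (rule subspace_sums[OF sub sub])
  have Lz: "L z \<notin> ?S"
  proof
    assume "L z \<in> ?S"
    then obtain a b where ab: "a \<in> E s" "b \<in> E (- s)" "L z = L a + L b" by auto
    then have "L z = L (a + b)" by (simp add: linear_add[OF L(1)])
    moreover have "a \<in> V" "b \<in> V" using ab EV by blast+
    ultimately have "z = a + b" by (intro inj_onD[OF L(2)]) auto
    moreover have "e a = 0" "e b = 0" using E_horizontal[OF s0 ab(1)] E_horizontal[OF _ ab(2)] s0 by auto
    ultimately show False using e_z lin(7)[of a b] ab EV by auto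
  qed
  have "?S \<inter> span {L z} = {0}"
  proof -
    have "y = 0" if y: "y \<in> ?S" "y \<in> span {L z}" for y
    proof (rule ccontr)
      obtain c where c: "y = c *\<^sub>R L z" using y(2) by (auto simp: span_singleton)
      assume "y \<noteq> 0"
      then have "L z = (1/c) *\<^sub>R y" using c by simp
      then have "L z \<in> ?S" using subspace_scale[OF subS y(1), of "1/c"] by (simp only:)
      then show False using Lz by contradiction
    qed
    then show ?thesis using subspace_0[OF subS] span_zero by blast
  qed
  moreover have "{x + y |x y. x \<in> ?S \<and> y \<in> span {L z}} = UNIV"
  proof -
    have "y \<in> {x + y |x y. x \<in> ?S \<and> y \<in> span {L z}}" for y
    proof -
      \<comment> \<open>split the horizontal part of \<open>v\<close> with the spectral projections $\frac12(1 \pm P/s)$\<close>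
      obtain v where v: "v \<in> V" "y = L v" using L(3) by (metis UNIV_I imageE)
      let ?u = "v - e v *\<^sub>R z"
      let ?a = "(1/2) *\<^sub>R (?u + (1/s) *\<^sub>R P v)" and ?b = "(1/2) *\<^sub>R (?u - (1/s) *\<^sub>R P v)"
      have PP: "P (P v) = (s * s) *\<^sub>R ?u" using P_P[OF v(1)] s by (simp add: power2_eq_square)
      have Pu: "P ?u = P v" using v by simp
      have "P ?a = (1/2) *\<^sub>R (P v + (1/s) *\<^sub>R ((s * s) *\<^sub>R ?u))" "P ?b = (1/2) *\<^sub>R (P v - (1/s) *\<^sub>R ((s * s) *\<^sub>R ?u))"
        using v by (simp_all add: PP)
      then have "P ?a = s *\<^sub>R ?a" "P ?b = (- s) *\<^sub>R ?b"
        using s0 by (simp_all add: scaleR_add_right scaleR_diff_right)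
      then have ab: "?a \<in> E s" "?b \<in> E (- s)" using v by (simp_all add: E_def)
      have "v = ?a + ?b + e v *\<^sub>R z" by (simp add: algebra_simps flip: scaleR_add_left)
      then have "y = L (?a + ?b + e v *\<^sub>R z)" using v(2) by metis
      then have "y = (L ?a + L ?b) + e v *\<^sub>R L z"
        using L(1) by (simp only: linear_add linear_scale)
      moreover have "e v *\<^sub>R L z \<in> span {L z}" by (simp add: span_base span_scale)
      ultimately show ?thesis using ab by blast
    qed
    then show ?thesis by blast
  qed
  ultimately have "DIM('e) = dim ?S + dim (span {L z})"
    using dim_sums_Int[OF subS subspace_span[of "{L z}"]] by (simp add: dim_UNIV)
  moreover have "dim (span {L z}) = 1"
  proof -
    have "L z \<noteq> 0" using Lz subspace_0[OF subS] by metis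
    then show ?thesis by (simp add: dim_singleton)
  qed
  ultimately show ?thesis using dS n by simp
qed

end


section \<open>Subbundles from global sections\<close>

text \<open>Diagonal dominance, applied to a coefficient \<open>c j\<close> of largest modulus.\<close>

lemma near_identity_nonsingular:
  fixes m :: "nat \<Rightarrow> nat \<Rightarrow> real"
  assumes m: "\<And>i j. i < k \<Longrightarrow> j < k \<Longrightarrow> \<bar>m i j - (if i = j then 1 else 0)\<bar> < 1 / (real k + 1)"
    and c: "\<And>j. j < k \<Longrightarrow> (\<Sum>i<k. c i * m i j) = 0" and i: "i < k"
  shows "c i = 0"
proof -
  have "Max ((\<lambda>i. \<bar>c i\<bar>) ` {..<k}) \<in> (\<lambda>i. \<bar>c i\<bar>) ` {..<k}" using i by (intro Max_in) auto
  then obtain j where j: "j < k" "\<bar>c j\<bar> = Max ((\<lambda>i. \<bar>c i\<bar>) ` {..<k})" by auto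
  then have max: "\<bar>c i\<bar> \<le> \<bar>c j\<bar>" if "i < k" for i using that by simp
  have "(\<Sum>i<k. c i * (m i j - (if i = j then 1 else 0))) = (\<Sum>i<k. c i * m i j) - (\<Sum>i<k. if i = j then c i else 0)"
    unfolding sum_subtractf[symmetric] by (rule sum.cong) (auto simp: algebra_simps)
  then have "(\<Sum>i<k. c i * (m i j - (if i = j then 1 else 0))) = - c j"
    using c[OF j(1)] j(1) by (simp add: sum.delta')
  then have "\<bar>c j\<bar> \<le> (\<Sum>i<k. \<bar>c i * (m i j - (if i = j then 1 else 0))\<bar>)"
    using sum_abs[of "\<lambda>i. c i * (m i j - (if i = j then 1 else 0))" "{..<k}"] by simp
  also have "\<dots> \<le> (\<Sum>i<k. \<bar>c j\<bar> * (1 / (real k + 1)))"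
  proof (rule sum_mono)
    fix i assume "i \<in> {..<k}"
    then show "\<bar>c i * (m i j - (if i = j then 1 else 0))\<bar> \<le> \<bar>c j\<bar> * (1 / (real k + 1))"
      unfolding abs_mult using max m[of i j] j(1) by (intro mult_mono less_imp_le[OF m]) auto
  qed
  also have "\<dots> = \<bar>c j\<bar> * (real k / (real k + 1))" by simp
  finally have "\<bar>c j\<bar> * (1 - real k / (real k + 1)) \<le> 0" by (simp add: algebra_simps)
  moreover have "1 - real k / (real k + 1) > (0::real)" by (simp add: field_simps)
  ultimately have "\<bar>c j\<bar> \<le> 0" by (simp add: mult_le_0_iff)
  then show ?thesis using max[OF i] by simp
qed

text \<open>A distribution of constant dimension, each vector of which extends to a global section, is a
  subbundle: sections extending a basis of \<open>D p\<close> stay independent near \<open>p\<close>. To see this, choose a dual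
  basis among the linear combinations of evaluations on global smooth functions; the matrix of its
  values on the sections is continuous and is the identity at \<open>p\<close>.\<close>

lemma subbundleI:
  fixes A :: "('a::{t2_space,second_countable_topology}, 'e::euclidean_space) atlas"
  assumes A: "smooth_atlas A"
    and D: "\<And>p. subspace (D p)" "\<And>p. D p \<subseteq> tangent_space A p" "\<And>p. dim (D p) = k"
    and ext: "\<And>p v. v \<in> D p \<Longrightarrow> \<exists>X\<in>sections A D. X p = v"
  shows "subbundle A k D"
  unfolding subbundle_def
proof (intro conjI allI D)
  fix p
  obtain x :: "'e \<Rightarrow> 'a \<Rightarrow> real" where x: "\<And>b. x b \<in> smooth_funs A"
    "inj_on (\<lambda>v. \<Sum>b\<in>Basis. v (x b) *\<^sub>R b) (tangent_space A p)"
    "(\<lambda>v. \<Sum>b\<in>Basis. v (x b) *\<^sub>R b) ` tangent_space A p = UNIV"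
    by (rule tangent_space_coordinates[OF A, of p], rule that)
  define L where "L v = (\<Sum>b\<in>Basis. v (x b) *\<^sub>R b)" for v :: "'a tvec"
  have L: "linear L"
    unfolding L_def[abs_def] by (rule linear_evaluation)
  have fin: "finite B \<and> independent (L ` B) \<and> inj_on L B" if B: "independent B" "B \<subseteq> D p" for B
  proof -
    have s: "span B \<subseteq> tangent_space A p"
      using B(2) D(2) subspace_tangent_space[OF A] by (meson order_trans span_minimal)
    have i: "inj_on L (span B)" using x(2) s unfolding L_def[abs_def] by (rule inj_on_subset)
    have "inj_on L B" using i by (meson inj_on_subset span_superset)
    moreover have "independent (L ` B)" by (rule linear_independent_injective_image[OF L B(1) i])
    ultimately show ?thesis using independent_imp_finite finite_imageD by blast
  qed
  obtain B where B: "B \<subseteq> D p" "independent B" "D p \<subseteq> span B" "card B = k"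
    using basis_exists[of "D p"] D(3)[of p] by metis
  note fB = fin[OF B(2,1)]
  obtain v where v: "bij_betw v {..<k} B"
    using ex_bij_betw_nat_finite[of B] fB B(4) by (auto simp: atLeast0LessThan)
  have vB: "v i \<in> B" if "i < k" for i using v that by (auto simp: bij_betw_def)
  have "\<forall>i. \<exists>X. i < k \<longrightarrow> X \<in> sections A D \<and> X p = v i" using ext vB B(1) by blast
  then obtain X where X: "\<And>i. i < k \<Longrightarrow> X i \<in> sections A D" "\<And>i. i < k \<Longrightarrow> X i p = v i"
    by metis
  have XV: "X i \<in> vector_fields A" "X i q \<in> D q" if "i < k" for i q
    using X(1)[OF that] by (auto simp: sections_def)
  have "\<forall>j. \<exists>f. linear f \<and> (\<forall>w\<in>L ` B. f w = (if w = L (v j) then 1 else (0::real)))"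
    by (intro allI linear_independent_extend) (use fB in simp)
  then obtain f where f: "\<And>j. linear (f j)" "\<And>j w. w \<in> L ` B \<Longrightarrow> f j w = (if w = L (v j) then 1 else (0::real))"
    by metis
  define m where "m q i j = f j (L (X i q))" for q i j
  have m_p: "m p i j = (if i = j then 1 else 0)" if "i < k" "j < k" for i j
  proof -
    have "L (v i) = L (v j) \<longleftrightarrow> i = j"
      using fB vB[OF that(1)] vB[OF that(2)] v that by (auto simp: inj_on_def bij_betw_def)
    then show ?thesis using f(2)[of "L (v i)" j] vB[OF that(1)] X(2)[OF that(1)] by (simp add: m_def)
  qed
  have m_cont: "continuous_on UNIV (\<lambda>q. m q i j)" if "i < k" for i j
  proof -
    have "continuous_on UNIV (\<lambda>q. L (X i q))"
      unfolding L_def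
      by (intro continuous_intros smooth_funs_continuous[OF A] vector_fieldsD(2)[OF A XV(1)[OF that] x(1)])
    moreover have "continuous_on UNIV (f j)"
      using f(1)[of j] by (simp add: linear_continuous_on linear_conv_bounded_linear)
    ultimately show ?thesis unfolding m_def using continuous_on_compose2 by blast
  qed
  define U where "U = (\<Inter>i\<in>{..<k}. \<Inter>j\<in>{..<k}. {q. \<bar>m q i j - (if i = j then 1 else 0)\<bar> < 1 / (real k + 1)})"
  have "open U"
    unfolding U_def
    by (intro open_INT finite_lessThan ballI open_Collect_less)
       (auto intro!: continuous_on_const continuous_on_rabs continuous_on_diff m_cont)
  moreover have "p \<in> U" by (auto simp: U_def m_p)
  moreover have "D q = span ((\<lambda>i. X i q) ` {..<k})" if q: "q \<in> U" for q
  proof -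
    have lin: "c i = 0" if z: "(\<Sum>i<k. c i *\<^sub>R X i q) = 0" and "i < k" for c i
    proof (rule near_identity_nonsingular[of k "m q" c, OF _ _ that(2)])
      show "\<bar>m q i j - (if i = j then 1 else 0)\<bar> < 1 / (real k + 1)" if "i < k" "j < k" for i j
        using q that by (auto simp: U_def)
      fix j
      have "f j (L (\<Sum>i<k. c i *\<^sub>R X i q)) = (\<Sum>i<k. c i * m q i j)"
        by (simp add: m_def linear_sum[OF L] linear_sum[OF f(1)] linear_scale[OF L] linear_scale[OF f(1)])
      then show "(\<Sum>i<k. c i * m q i j) = 0" using z by (simp add: linear_0[OF L] linear_0[OF f(1)])
    qed
    have inj: "inj_on (\<lambda>i. X i q) {..<k}"
    proof (rule inj_onI, rule ccontr)
      fix i j assume ij: "i \<in> {..<k}" "j \<in> {..<k}" "X i q = X j q" "i \<noteq> j"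
      let ?c = "\<lambda>l. (if l = i then 1 else 0) - (if l = j then 1 else (0::real))"
      have "(\<Sum>l<k. ?c l *\<^sub>R X l q) = (\<Sum>l<k. (if l = i then X l q else 0)) - (\<Sum>l<k. (if l = j then X l q else 0))"
        unfolding sum_subtractf[symmetric] by (rule sum.cong) (auto simp: algebra_simps)
      also have "\<dots> = 0" using ij by (simp add: sum.delta')
      finally have "?c i = 0" using ij(1) by (intro lin) auto
      then show False using ij(4) by simp
    qed
    let ?S = "(\<lambda>i. X i q) ` {..<k}"
    have ind: "independent ?S"
    proof (rule ccontr)
      assume "\<not> independent ?S"
      then obtain u w where u: "w \<in> ?S" "u w \<noteq> 0" "(\<Sum>w\<in>?S. u w *\<^sub>R w) = 0"
        by (auto simp: dependent_finite)
      then have "(\<Sum>i<k. u (X i q) *\<^sub>R X i q) = 0" by (simp add: sum.reindex[OF inj])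
      then show False using lin[of "\<lambda>i. u (X i q)"] u(1,2) by auto
    qed
    have SD: "?S \<subseteq> D q" using XV(2) by auto
    have "D q \<subseteq> span ?S"
    proof (rule ccontr)
      assume "\<not> D q \<subseteq> span ?S"
      then obtain w where w: "w \<in> D q" "w \<notin> span ?S" by auto
      have i: "independent (insert w ?S)" using ind w(2) by (simp add: independent_insert)
      obtain x' :: "'e \<Rightarrow> 'a \<Rightarrow> real" where x': "inj_on (\<lambda>v. \<Sum>b\<in>Basis. v (x' b) *\<^sub>R b) (tangent_space A q)"
        by (rule tangent_space_coordinates[OF A, of q], rule that)
      define L' where "L' v = (\<Sum>b\<in>Basis. v (x' b) *\<^sub>R b)" for v :: "'a tvec"
      have L': "linear L'"
        unfolding L'_def[abs_def] by (rule linear_evaluation)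
      have i': "inj_on L' (tangent_space A q)" using x' unfolding L'_def[abs_def] .
      have s: "insert w ?S \<subseteq> tangent_space A q" using SD w(1) D(2) by auto
      have "independent (L' ` insert w ?S)"
        by (rule linear_independent_injective_image[OF L' i inj_on_subset[OF i']])
           (rule span_minimal[OF s subspace_tangent_space[OF A]])
      moreover have "L' ` insert w ?S \<subseteq> L' ` D q" using SD w(1) by auto
      ultimately have "card (L' ` insert w ?S) \<le> dim (L' ` D q)" by (rule independent_card_le_dim[rotated])
      moreover have "dim (L' ` D q) = k"
        using dim_image_inj[OF L' i' subspace_tangent_space[OF A] D(2)] D(3) by simp
      moreover have "card (L' ` insert w ?S) = Suc k"
      proof -
        have "w \<notin> ?S" using w(2) by (rule contrapos_nn) (rule span_base)
        then have "card (insert w ?S) = Suc k" by (simp add: card_image[OF inj])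
        then show ?thesis using card_image[OF inj_on_subset[OF i' s]] by simp
      qed
      ultimately show False by simp
    qed
    then show ?thesis using span_minimal[OF SD D(1)] by blast
  qed
  ultimately show "\<exists>U E. open U \<and> p \<in> U \<and> (\<forall>i<k. E i \<in> vector_fields_on A U) \<and>
      (\<forall>q\<in>U. D q = span ((\<lambda>i. E i q) ` {..<k}))"
    using XV(1) vector_fields_restrict[OF A] by (intro exI[of _ U] exI[of _ X]) auto
qed


section \<open>The operator $\phi h$ of a non-Sasakian $(\kappa,\mu)$-manifold\<close>

locale non_sasakian_kappa_mu = kappa_mu A n \<phi> \<xi> \<eta> g nabla \<kappa> \<mu>
  for A :: "('a::{t2_space,second_countable_topology}, 'e::euclidean_space) atlas"
    and n :: nat and \<phi> \<xi> \<eta> g nabla \<kappa> \<mu> +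
  assumes non_sasakian: "\<not> sasakian A n \<phi> \<xi> \<eta> g"
begin

definition phi_h :: "'a endo_field" where
  "phi_h p v = \<phi> p (contact_h A \<phi> \<xi> p v)"

definition lam :: real where
  "lam = sqrt (1 - \<kappa>)"

lemma phi_h_at: "X \<in> VF \<Longrightarrow> phi_h p (X p) = P X p"
  by (simp add: phi_h_def phi_contact_h_at)

lemma contact_h_eq: "v \<in> Tan p \<Longrightarrow> contact_h A \<phi> \<xi> p v = phi_h p (\<phi> p v)"
  using extension[of v p] contact_h_at phi_h_at[OF phi_VF] by (force simp: app_def[of \<phi>])

lemma eta_ip: "X \<in> VF \<Longrightarrow> \<eta> p (X p) = ip X \<xi> p"
  using fun_cong[OF eta_field, of X p] by (simp add: app_def)

text \<open>\<open>P X\<close> is nonzero somewhere, and there $0 < |PX|^2 = (1-\kappa)\,|\phi X|^2$.\<close>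

lemma kappa_less_1: "\<kappa> < 1"
proof -
  obtain X p where X: "X \<in> VF" "P X p \<noteq> 0"
    using sasakian_if_P_zero non_sasakian by (metis ext zero_fun_apply)
  have "0 < ip (P X) (P X) p" using metric_pos[OF _ X(2)] X(1) by (simp add: app2_def)
  then have pos: "0 < (1 - \<kappa>) * ip (phi X) (phi X) p" using P_P_ip[OF X(1,1)] by simp
  have "0 \<le> ip (phi X) (phi X) p"
  proof (cases "phi X p = 0")
    case True
    then have "ip (phi X) (phi X) p = ip (phi X) 0 p" by (simp add: app2_def)
    then show ?thesis using X(1) by simp
  next
    case False
    then show ?thesis using metric_pos[of "phi X p" p] X(1) by (simp add: app2_def)
  qed
  then show ?thesis using pos by (simp add: zero_less_mult_iff)
qed

lemma lam_pos: "0 < lam" and lam_square: "lam\<^sup>2 = 1 - \<kappa>"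
  using kappa_less_1 by (simp_all add: lam_def)

lemma pointwise: "contact_vector_space (Tan p) (\<phi> p) (phi_h p) (\<xi> p) (\<eta> p) lam"
proof
  show "subspace (Tan p)" by (rule Tan_subspace)
  show "linear_map_on (Tan p) (\<phi> p)" "linear_map_on (Tan p) (\<eta> p)" by (rule phi_linear eta_linear)+
  show "linear_map_on (Tan p) (phi_h p)"
    unfolding linear_map_on_def
  proof (intro conjI ballI allI)
    fix v w c assume v: "v \<in> Tan p" and w: "w \<in> Tan p"
    obtain X Y where X: "X \<in> VF" "X p = v" and Y: "Y \<in> VF" "Y p = w" using extension v w by metis
    show "phi_h p (v + w) = phi_h p v + phi_h p w"
      using phi_h_at[of "X + Y" p] phi_h_at[of X p] phi_h_at[of Y p] X Y by (simp add: P_add)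
  next
    fix v c assume v: "v \<in> Tan p"
    obtain X where X: "X \<in> VF" "X p = v" using extension v by metis
    show "phi_h p (c *\<^sub>R v) = c *\<^sub>R phi_h p v"
      using phi_h_at[of "c *\<^sub>R X" p] phi_h_at[of X p] X by (simp add: P_scaleR)
  qed
  show "phi_h p (\<xi> p) = 0" using phi_h_at[of \<xi> p] by simp
  show "\<eta> p (\<xi> p) = 1" by (rule eta_xi_at)
  show "0 < lam" by (rule lam_pos)
  show "\<xi> p \<in> Tan p" by simp
  fix v assume v: "v \<in> Tan p"
  then obtain X where X: "X \<in> VF" "v = X p" using extension by metis
  have ph: "\<phi> p (Y p) = phi Y p" for Y by (simp add: app_def)
  show "\<phi> p v \<in> Tan p" using v by simp
  show "phi_h p v \<in> Tan p" using X by (simp add: phi_h_at)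
  show "\<eta> p (\<phi> p v) = 0" unfolding X(2) ph using X(1) by (simp only: eta_ip phi_VF eta_phi)
  show "\<eta> p (phi_h p v) = 0" unfolding X(2) using X(1) by (simp only: phi_h_at eta_ip P_VF eta_P)
  show "\<phi> p (\<phi> p v) = - v + \<eta> p v *\<^sub>R \<xi> p" by (rule phi_phi_at[OF v])
  show "\<phi> p (phi_h p v) = - phi_h p (\<phi> p v)"
    unfolding X(2) ph phi_h_at[OF X(1)] phi_h_at[OF phi_VF[OF X(1)]] phi_P[OF X(1)] by simp
  show "phi_h p (phi_h p v) = lam\<^sup>2 *\<^sub>R (v - \<eta> p v *\<^sub>R \<xi> p)"
    unfolding X(2) phi_h_at[OF X(1)] phi_h_at[OF P_VF[OF X(1)]] P_P[OF X(1)] eta_ip[OF X(1)]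
    by (simp add: lam_square fsmul_def)
qed

sublocale at: contact_vector_space "Tan p" "\<phi> p" "phi_h p" "\<xi> p" "\<eta> p" lam for p
  by (rule pointwise)

abbreviation D :: "real \<Rightarrow> 'a distribution" where
  "D s \<equiv> eigendistribution A phi_h s"

lemma D_eq: "D s p = at.E p s"
  by (simp add: eigendistribution_def at.E_def)

lemma h_eigen_eq: "eigendistribution A (contact_h A \<phi> \<xi>) t p = at.H p t"
  by (auto simp: eigendistribution_def at.H_def contact_h_eq)

lemma dim_D:
  assumes s: "s\<^sup>2 = lam\<^sup>2"
  shows "dim (D s p) = n"
proof -
  obtain L :: "'a tvec \<Rightarrow> 'e" where L: "linear L" "inj_on L (Tan p)" "L ` Tan p = UNIV"
    and dim: "DIM('e) = 2 * n + 1"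
    by (rule tangent_coordinates[of p], rule that)
  show ?thesis unfolding D_eq by (rule at.dim_E[OF L dim s])
qed

text \<open>For \<open>n = 0\<close> the eigenspaces would be trivial, hence \<open>P = 0\<close> and the manifold Sasakian.\<close>

lemma n_pos: "n \<noteq> 0"
proof
  assume n: "n = 0"
  have "P X = 0" if X: "X \<in> VF" for X
  proof
    fix p
    obtain L :: "'a tvec \<Rightarrow> 'e" where L: "linear L" "inj_on L (Tan p)" by (rule tangent_coordinates[of p], rule that)
    have sub: "at.E p lam \<subseteq> Tan p" by (auto simp: at.E_def)
    have "dim (L ` at.E p lam) = 0"
      using dim_image_inj[OF L Tan_subspace sub] dim_D[of lam p] n by (simp add: D_eq)
    then have L0: "L ` at.E p lam \<subseteq> {0}" by (simp only: dim_eq_0)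
    have "v = 0" if v: "v \<in> at.E p lam" for v
    proof (rule inj_onD[OF L(2)])
      show "L v = L 0" using L0 v linear_0[OF L(1)] by auto
      show "v \<in> Tan p" using v sub by blast
    qed simp
    then have "at.E p lam = {0}" using subspace_0[OF at.subspace_E] by blast
    then have "phi_h p (X p) = 0" by (rule at.P_zero_if_E_trivial) (simp add: X)
    then show "P X p = 0 p" using X by (simp add: phi_h_at)
  qed
  then show False using sasakian_if_P_zero non_sasakian by blast
qed

lemma D_nontrivial:
  assumes "s\<^sup>2 = lam\<^sup>2"
  shows "\<exists>v\<in>Tan p. v \<noteq> 0 \<and> phi_h p v = s *\<^sub>R v"
proof (rule ccontr)
  assume "\<not> ?thesis"
  then have "D s p = {0}"
    using subspace_0[OF at.subspace_E[of p s]] by (auto simp: D_eq at.E_def)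
  then show False using dim_D[OF assms, of p] n_pos by (simp add: dim_zero_space)
qed

lemma xi_nonzero: "\<xi> p \<noteq> 0"
proof
  assume "\<xi> p = 0"
  then have "\<eta> p 0 = 1" using eta_xi_at[of p] by (simp only:)
  then show False using at.lin(12)[of "\<xi> p" p "\<xi> p"] by simp
qed

lemma eigenvalues: "eigenvalues_at A phi_h p = {0, lam, - lam}"
proof
  show "eigenvalues_at A phi_h p \<subseteq> {0, lam, - lam}"
    using at.eigenvalue_cases by (auto simp: eigenvalues_at_def)
  have "0 \<in> eigenvalues_at A phi_h p"
    using xi_nonzero[of p] at.P_z[of p] by (auto simp: eigenvalues_at_def intro!: bexI[of _ "\<xi> p"])
  then show "{0, lam, - lam} \<subseteq> eigenvalues_at A phi_h p"
    using D_nontrivial[of lam p] D_nontrivial[of "- lam" p] by (auto simp: eigenvalues_at_def)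
qed

lemma D_0: "D 0 p = span {\<xi> p}"
  unfolding D_eq by (rule at.E_0)

lemma dim_D_0: "dim (D 0 p) = 1"
  using xi_nonzero[of p] unfolding D_0 by (simp add: dim_eq_card_independent)

lemma section_iff: "X \<in> sections A (D s) \<longleftrightarrow> X \<in> VF \<and> P X = s *\<^sub>R X"
proof -
  have "P X = s *\<^sub>R X \<longleftrightarrow> (\<forall>p. P X p = s *\<^sub>R X p)"
    by (metis ext scaleR_fun_apply)
  then show ?thesis by (auto simp: sections_def eigendistribution_def phi_h_at)
qed

lemma sections_D:
  assumes s: "s\<^sup>2 = lam\<^sup>2"
  shows "sections A (D s) = {X + phi X | X. X \<in> sections A (eigendistribution A (contact_h A \<phi> \<xi>) s)}"
proof (intro equalityI subsetI)
  fix X assume X: "X \<in> sections A (D s)"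
  let ?Y = "(1/2) *\<^sub>R (X - phi X)"
  have s0: "s \<noteq> 0" using s lam_pos by auto
  have XV: "X \<in> VF" "X p \<in> at.E p s" for p using X by (auto simp: sections_def D_eq)
  note w = at.E_in_graph[OF s0 XV(2)]
  have "?Y p = (1/2) *\<^sub>R (X p - \<phi> p (X p))" for p by (simp add: app_def)
  then have "?Y \<in> sections A (eigendistribution A (contact_h A \<phi> \<xi>) s)"
    using w(1) XV(1) unfolding sections_def h_eigen_eq by (simp only: mem_Collect_eq) simp
  moreover have "X p = (?Y + phi ?Y) p" for p using w(2)[of p] by (simp add: app_def)
  then have "X = ?Y + phi ?Y" by (rule ext)
  ultimately show "X \<in> {X + phi X | X. X \<in> sections A (eigendistribution A (contact_h A \<phi> \<xi>) s)}" by blast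
next
  fix Z assume "Z \<in> {X + phi X | X. X \<in> sections A (eigendistribution A (contact_h A \<phi> \<xi>) s)}"
  then obtain X where X: "X \<in> VF" "\<And>p. X p \<in> at.H p s" "Z = X + phi X"
    by (auto simp: sections_def h_eigen_eq)
  have "Z p \<in> D s p" for p
    unfolding D_eq using at.graph_in_E[OF s X(2)[of p]] X(3) by (simp add: app_def)
  then show "Z \<in> sections A (D s)" using X by (simp add: sections_def)
qed

lemma legendre_D:
  assumes s: "s\<^sup>2 = lam\<^sup>2"
  shows "legendre_foliation A n \<eta> (D s)"
  unfolding legendre_foliation_def
proof (intro conjI allI ballI)
  have s0: "s \<noteq> 0" using s lam_pos by auto
  show "subbundle A n (D s)"
  proof (rule subbundleI[OF atlas])
    show "subspace (D s p)" for p unfolding D_eq by (rule at.subspace_E)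
    show "D s p \<subseteq> Tan p" for p by (auto simp: eigendistribution_def)
    show "dim (D s p) = n" for p by (rule dim_D[OF s])
    fix p v assume v: "v \<in> D s p"
    then have vT: "v \<in> Tan p" and Pv: "phi_h p v = s *\<^sub>R v" by (auto simp: eigendistribution_def)
    have ev: "\<eta> p v = 0" using at.E_horizontal[OF s0] v by (simp add: D_eq)
    obtain X where X: "X \<in> VF" "X p = v" using extension vT by metis
    \<comment> \<open>the spectral projection of an arbitrary extension of \<open>v\<close>\<close>
    let ?Y = "(1/2) *\<^sub>R (X - ip X \<xi> \<odot> \<xi> + (1/s) *\<^sub>R P X)"
    have YV: "?Y \<in> VF" using X(1) by simp
    have "P ?Y = s *\<^sub>R ?Y"
    proof (rule field_eqI_global)
      fix Z q assume Z: "Z \<in> VF"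
      have "ip (P X) (P Z) q = (s * s) * (ip X Z q - ip X \<xi> q * ip \<xi> Z q)"
        using P_P_ip[OF X(1) Z, of q] s X(1) Z
        by (simp add: lam_square compat ip_sym[of \<xi> Z] flip: power2_eq_square)
      then have "ip X (P (P Z)) q = (s * s) * (ip X Z q - ip X \<xi> q * ip \<xi> Z q)"
        using X(1) Z by (simp add: P_sym)
      then show "ip (P ?Y) Z q = ip (s *\<^sub>R ?Y) Z q"
        using X(1) Z s0 ip_sym[of \<xi> "P Z"] by (simp add: P_sym) (simp add: algebra_simps)
    qed (use YV vector_fields_scaleR[OF atlas YV, of s] in simp_all)
    then have "?Y \<in> sections A (D s)" using YV by (simp add: section_iff)
    moreover have "?Y p = v"
    proof -
      have "P X p = s *\<^sub>R v" "ip X \<xi> p = 0"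
        using X(2) Pv ev phi_h_at[OF X(1), of p] eta_ip[OF X(1), of p] by simp_all
      then have "?Y p = (1/2) *\<^sub>R (v + v)" using X(2) s0 by (simp add: fsmul_def)
      also have "\<dots> = v" by (rule scaleR_half_double)
      finally show ?thesis .
    qed
    ultimately show "\<exists>Y\<in>sections A (D s). Y p = v" by blast
  qed
  show "involutive A (D s)"
    using eigenfields_involutive[OF _ _ _ _ s0] s lam_square
    by (auto simp: involutive_def section_iff)
  show "\<eta> p v = 0" if "v \<in> D s p" for p v
    using at.E_horizontal[OF s0] that by (simp add: D_eq)
qed

lemma orthogonal_D: "mutually_orthogonal g (D lam) (D (- lam))"
  unfolding mutually_orthogonal_def
proof (intro allI ballI)
  fix p v w assume "v \<in> D lam p" "w \<in> D (- lam) p"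
  then have v: "v \<in> Tan p" "phi_h p v = lam *\<^sub>R v" and w: "w \<in> Tan p" "phi_h p w = (- lam) *\<^sub>R w"
    by (auto simp: eigendistribution_def)
  obtain X Y where X: "X \<in> VF" "X p = v" and Y: "Y \<in> VF" "Y p = w" using extension v(1) w(1) by metis
  have PX: "P X p = (lam *\<^sub>R X) p" "P Y p = ((- lam) *\<^sub>R Y) p"
    using phi_h_at[OF X(1), of p] phi_h_at[OF Y(1), of p] X(2) Y(2) v(2) w(2) by simp_all
  have "ip (lam *\<^sub>R X) Y p = ip X ((- lam) *\<^sub>R Y) p"
    using P_sym[OF X(1) Y(1), of p] unfolding app2_def PX .
  then have "ip X Y p = 0" using X(1) Y(1) lam_pos by simp
  then show "g p v w = 0" using X(2) Y(2) by (simp add: app2_def)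
qed

lemma transversal_D:
  assumes "s\<^sup>2 = lam\<^sup>2" "t\<^sup>2 = lam\<^sup>2"
  shows "transversal A \<xi> (D s) (eigendistribution A (contact_h A \<phi> \<xi>) t)"
  unfolding transversal_def D_eq h_eigen_eq using at.transversal_E_H[OF assms] by blast

end

theorem theorem5p2:
  fixes A :: "('a::{t2_space,second_countable_topology}, 'e::euclidean_space) atlas"
    and n :: nat
    and \<phi> h \<phi>h :: "'a endo_field" and \<xi> :: "'a vfield" and \<eta> :: "'a form1" and g :: "'a form2"
    and \<kappa> \<mu> lam :: real
  assumes "kappa_mu_manifold A n \<phi> \<xi> \<eta> g \<kappa> \<mu>"
    and "\<not> sasakian A n \<phi> \<xi> \<eta> g"
    and "lam = sqrt (1 - \<kappa>)"
    and "h = contact_h A \<phi> \<xi>"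
    and "\<phi>h = (\<lambda>p v. \<phi> p (h p v))"
  shows "(\<forall>p. eigenvalues_at A \<phi>h p = {0, lam, -lam}) \<and> distinct [0, lam, -lam] \<and>
     (\<forall>p. dim (eigendistribution A \<phi>h 0 p) = 1 \<and>
       dim (eigendistribution A \<phi>h lam p) = n \<and>
       dim (eigendistribution A \<phi>h (-lam) p) = n) \<and>
     (\<forall>p. eigendistribution A \<phi>h 0 p = span {\<xi> p}) \<and>
     sections A (eigendistribution A \<phi>h lam) =
       {X + app \<phi> X | X. X \<in> sections A (eigendistribution A h lam)} \<and>
     (\<forall>p. eigendistribution A \<phi>h lam p = {v + \<phi> p v | v. v \<in> eigendistribution A h lam p}) \<and>
     sections A (eigendistribution A \<phi>h (-lam)) =
       {Y + app \<phi> Y | Y. Y \<in> sections A (eigendistribution A h (-lam))} \<and>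
     (\<forall>p. eigendistribution A \<phi>h (-lam) p = {v + \<phi> p v | v. v \<in> eigendistribution A h (-lam) p}) \<and>
     legendre_foliation A n \<eta> (eigendistribution A \<phi>h lam) \<and>
     legendre_foliation A n \<eta> (eigendistribution A \<phi>h (-lam)) \<and>
     mutually_orthogonal g (eigendistribution A \<phi>h lam) (eigendistribution A \<phi>h (-lam)) \<and>
     (\<forall>s\<in>{lam, -lam}. \<forall>t\<in>{lam, -lam}.
       transversal A \<xi> (eigendistribution A \<phi>h s) (eigendistribution A h t))"
proof -
  obtain nabla where nabla: "levi_civita A g nabla"
    "\<forall>X\<in>vector_fields A. \<forall>Y\<in>vector_fields A.
          curvature nabla X Y \<xi> =
            \<kappa> *\<^sub>R (app \<eta> Y \<odot> X - app \<eta> X \<odot> Y) +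
            \<mu> *\<^sub>R (app \<eta> Y \<odot> app (contact_h A \<phi> \<xi>) X - app \<eta> X \<odot> app (contact_h A \<phi> \<xi>) Y)"
    using assms(1) unfolding kappa_mu_manifold_def by blast
  have contact: "contact_metric_manifold A n \<phi> \<xi> \<eta> g"
    using assms(1) unfolding kappa_mu_manifold_def by blast
  interpret M: non_sasakian_kappa_mu A n \<phi> \<xi> \<eta> g nabla \<kappa> \<mu>
    by unfold_locales (use contact nabla assms(2) in blast)+
  have lam: "lam = M.lam" using assms(3) by (simp add: M.lam_def)
  have ph: "\<phi>h = M.phi_h" unfolding assms(4,5) M.phi_h_def by (rule refl)
  have sq: "M.lam\<^sup>2 = M.lam\<^sup>2" "(- M.lam)\<^sup>2 = M.lam\<^sup>2" by simp_all
  have graph: "eigendistribution A M.phi_h s p = {v + \<phi> p v | v. v \<in> eigendistribution A (contact_h A \<phi> \<xi>) s p}"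
    if "s\<^sup>2 = M.lam\<^sup>2" for s p
    unfolding M.D_eq M.h_eigen_eq by (rule M.at.E_eq_graph[OF that])
  have "distinct [0, M.lam, - M.lam]" using M.lam_pos by simp
  moreover have "\<forall>s\<in>{M.lam, - M.lam}. \<forall>t\<in>{M.lam, - M.lam}.
      transversal A \<xi> (eigendistribution A M.phi_h s) (eigendistribution A (contact_h A \<phi> \<xi>) t)"
    using M.transversal_D sq by blast
  ultimately show ?thesis
    unfolding lam ph assms(4)
    using M.eigenvalues M.dim_D_0 M.dim_D[OF sq(1)] M.dim_D[OF sq(2)] M.D_0
      M.sections_D[OF sq(1)] M.sections_D[OF sq(2)] graph[OF sq(1)] graph[OF sq(2)]
      M.legendre_D[OF sq(1)] M.legendre_D[OF sq(2)] M.orthogonal_D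
    by (intro conjI allI) assumption+
qed

end
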